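(* Fix $d\ge1$ and let $V:\mathbb R^d\to\mathbb R$ belong to $\mathscr V$ and to $\mathscr V_N$ on $\mathbb T_L^d$ for all sufficiently large $L$, satisfy condition–K, and have, for all sufficiently large $L$, a discontinuous (i.e. not lower critical) lower transition at $\theta_T^{[L]}$. Then $\lim_{L\to\infty}\theta_T^{[L]}$ exists and is strictly positive.
   Context: $\mathbb T_L^d=\mathbb R^d/(L\mathbb Z)^d$. The class $\mathscr V$ consists of measurable $V:\mathbb R^d\to\mathbb R$ with $V\in L^1(\mathbb R^d)$, $V^-\in L^\infty$, $V(x)=V(-x)$, $V(x)=0$ for $|x|>a$ (with $a<L/2$); $V$ is periodized to $\mathbb T_L^d$ and $\hat V(k)=\int_{\mathbb T_L^d}V(x)e^{-ik\cdot x}dx$. $\mathscr V_N$ (on $\mathbb T_L^d$) = those $V$ with $\hat V(k)<0$ for some $k\neq0$. $\mathscr P^{[L]}$ = probability densities on $\mathbb T_L^d$, $\rho_0^{[L]}\equiv L^{-d}$. $\mathcal F^{[L]}_\theta(\rho)=\int\rho\log\rho\,dx+\tfrac12\theta L^d\iint V(x-y)\rho(x)\rho(y)\,dx\,dy$ over $\mathbb T_L^d$. Condition–K: $|V(x)|\le V_{\max}<\infty$ for all $x$, and for all $L$ sufficiently large $\iint_{\mathbb T_L^d\times\mathbb T_L^d}V(x-y)\rho(x)\rho(y)\,dx\,dy\ge0$ for all $\rho\in\mathscr P^{[L]}$. Lower transition point: $\theta_T^{[L]}=\sup\{\theta\ge0:\rho_0^{[L]}$ is the unique minimizer of $\mathcal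 F^{[L]}_{\theta'}$ for all $\theta'\le\theta\}$. A lower critical point $\theta_c$ on $\mathbb T_L^d$: (1) for $\theta\le\theta_c$, $\rho_0^{[L]}$ is the unique minimizer; (2) for $\theta>\theta_c$ a minimizer $\rho_\theta\ne\rho_0^{[L]}$ exists; (3) every such family satisfies $\limsup_{\theta\downarrow\theta_c}\|\rho_\theta-\rho_0^{[L]}\|_{L^1}=0$. *)

theory Defs
  imports "HOL-Analysis.Analysis"
begin

text \<open>The torus T_L^d is represented by the fundamental cube [0,L]^d; functions on the
torus are functions on real^'n, only their values on the cube matter (periodized
potential is genuinely L-periodic). The dimension d is CARD('n).\<close>

definition torus_box :: "real \<Rightarrow> (real^'n) set" where
  "torus_box L = cbox 0 (\<chi> i. L)"

definition periodize :: "real \<Rightarrow> (real^'n \<Rightarrow> real) \<Rightarrow> real^'n \<Rightarrow> real" where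
  "periodize L V x = infsum (\<lambda>m::int^'n. V (x + (\<chi> i. L * of_int (m$i)))) UNIV"

definition dual_lattice :: "real \<Rightarrow> (real^'n) set" where
  "dual_lattice L = {k. \<exists>m::int^'n. k = (\<chi> i. 2 * pi / L * of_int (m$i))}"

definition fourier_coeff :: "real \<Rightarrow> (real^'n \<Rightarrow> real) \<Rightarrow> real^'n \<Rightarrow> complex" where
  "fourier_coeff L V k =
     integral\<^sup>L (lebesgue_on (torus_box L))
       (\<lambda>x. complex_of_real (periodize L V x) * cis (- (k \<bullet> x)))"

definition class_V :: "(real^'n \<Rightarrow> real) \<Rightarrow> bool" where
  "class_V V \<longleftrightarrow> V \<in> borel_measurable lebesgue \<and> integrable lebesgue V
     \<and> (\<exists>C. AE x in lebesgue. - C \<le> V x)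
     \<and> (\<forall>x. V (- x) = V x)
     \<and> (\<exists>a. \<forall>x. norm x > a \<longrightarrow> V x = 0)"

definition in_VN :: "real \<Rightarrow> (real^'n \<Rightarrow> real) \<Rightarrow> bool" where
  "in_VN L V \<longleftrightarrow> (\<exists>k\<in>dual_lattice L. k \<noteq> 0 \<and>
      (\<exists>r::real. r < 0 \<and> fourier_coeff L V k = complex_of_real r))"

definition densities :: "real \<Rightarrow> (real^'n \<Rightarrow> real) set" where
  "densities L = {\<rho>. \<rho> \<in> borel_measurable (lebesgue_on (torus_box L))
     \<and> (\<forall>x\<in>torus_box L. 0 \<le> \<rho> x)
     \<and> integrable (lebesgue_on (torus_box L)) \<rho>
     \<and> integral\<^sup>L (lebesgue_on (torus_box L)) \<rho> = 1}"

definition rho0 :: "real \<Rightarrow> real^'n \<Rightarrow> real" where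
  "rho0 L = (\<lambda>x. 1 / L ^ CARD('n))"

definition interaction :: "real \<Rightarrow> (real^'n \<Rightarrow> real) \<Rightarrow> (real^'n \<Rightarrow> real) \<Rightarrow> real" where
  "interaction L V \<rho> =
     integral\<^sup>L (lebesgue_on (torus_box L))
       (\<lambda>x. integral\<^sup>L (lebesgue_on (torus_box L))
               (\<lambda>y. periodize L V (x - y) * \<rho> y) * \<rho> x)"

definition free_energy :: "real \<Rightarrow> (real^'n \<Rightarrow> real) \<Rightarrow> real \<Rightarrow> (real^'n \<Rightarrow> real) \<Rightarrow> ereal" where
  "free_energy L V \<theta> \<rho> =
     (if integrable (lebesgue_on (torus_box L)) (\<lambda>x. \<rho> x * ln (\<rho> x))
      then ereal (integral\<^sup>L (lebesgue_on (torus_box L)) (\<lambda>x. \<rho> x * ln (\<rho> x))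
                  + 1/2 * \<theta> * L ^ CARD('n) * interaction L V \<rho>)
      else \<infinity>)"

definition is_minimizer :: "real \<Rightarrow> (real^'n \<Rightarrow> real) \<Rightarrow> real \<Rightarrow> (real^'n \<Rightarrow> real) \<Rightarrow> bool" where
  "is_minimizer L V \<theta> \<rho> \<longleftrightarrow> \<rho> \<in> densities L \<and>
     (\<forall>\<sigma>\<in>densities L. free_energy L V \<theta> \<rho> \<le> free_energy L V \<theta> \<sigma>)"

definition same_density :: "real \<Rightarrow> (real^'n \<Rightarrow> real) \<Rightarrow> (real^'n \<Rightarrow> real) \<Rightarrow> bool" where
  "same_density L \<rho> \<sigma> \<longleftrightarrow> (AE x in lebesgue_on (torus_box L). \<rho> x = \<sigma> x)"

definition unique_min_rho0 :: "real \<Rightarrow> (real^'n \<Rightarrow> real) \<Rightarrow> real \<Rightarrow> bool" where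
  "unique_min_rho0 L V \<theta> \<longleftrightarrow> is_minimizer L V \<theta> (rho0 L) \<and>
     (\<forall>\<rho>. is_minimizer L V \<theta> \<rho> \<longrightarrow> same_density L \<rho> (rho0 L))"

definition lower_transition :: "real \<Rightarrow> (real^'n \<Rightarrow> real) \<Rightarrow> real" where
  "lower_transition L V = Sup {\<theta>. 0 \<le> \<theta> \<and>
      (\<forall>\<theta>'. 0 \<le> \<theta>' \<and> \<theta>' \<le> \<theta> \<longrightarrow> unique_min_rho0 L V \<theta>')}"

definition L1_dist :: "real \<Rightarrow> (real^'n \<Rightarrow> real) \<Rightarrow> (real^'n \<Rightarrow> real) \<Rightarrow> real" where
  "L1_dist L \<rho> \<sigma> = integral\<^sup>L (lebesgue_on (torus_box L)) (\<lambda>x. \<bar>\<rho> x - \<sigma> x\<bar>)"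

definition lower_critical :: "real \<Rightarrow> (real^'n \<Rightarrow> real) \<Rightarrow> real \<Rightarrow> bool" where
  "lower_critical L V \<theta>c \<longleftrightarrow>
     (\<forall>\<theta>. 0 \<le> \<theta> \<and> \<theta> \<le> \<theta>c \<longrightarrow> unique_min_rho0 L V \<theta>)
   \<and> (\<forall>\<theta>>\<theta>c. \<exists>\<rho>. is_minimizer L V \<theta> \<rho> \<and> \<not> same_density L \<rho> (rho0 L))
   \<and> (\<forall>\<rho> :: real \<Rightarrow> real^'n \<Rightarrow> real.
        (\<forall>\<theta>>\<theta>c. is_minimizer L V \<theta> (\<rho> \<theta>) \<and> \<not> same_density L (\<rho> \<theta>) (rho0 L)) \<longrightarrow>
        Limsup (at_right \<theta>c) (\<lambda>\<theta>. ereal (L1_dist L (\<rho> \<theta>) (rho0 L))) = 0)"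

definition condition_K :: "(real^'n \<Rightarrow> real) \<Rightarrow> bool" where
  "condition_K V \<longleftrightarrow> (\<exists>Vmax. \<forall>x. \<bar>V x\<bar> \<le> Vmax)
     \<and> (\<exists>L0. \<forall>L\<ge>L0. \<forall>\<rho>\<in>densities L. 0 \<le> interaction L V \<rho>)"

end

theory Submission
  imports Defs
begin

text \<open>
  Write a density as \<open>\<rho> = (1 + f) / L^d\<close> with \<open>f \<ge> -1\<close> of mean zero. Then
  \<open>L^d (F(\<rho>) - F(\<rho>\<^sub>0)) = \<integral> \<psi>(f) + (\<theta> / 2) \<integral>\<integral> V(x - y) f(x) f(y)\<close> with
  \<open>\<psi>(t) = (1 + t) ln (1 + t) - t\<close>; call the right-hand side the excess of \<open>f\<close>.

  Positivity. Split \<open>f\<close> into the part \<open>f\<^sub>1\<close> where \<open>f \<le> 3\<close> and the part \<open>f\<^sub>2 \<ge> 0\<close> where \<open>f > 3\<close>.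
  Condition K discards the self-interaction of \<open>f\<^sub>2\<close>, all other terms are at least
  \<open>- C (\<integral> f\<^sub>1\<^sup>2 + \<integral> f\<^sub>2)\<close> with \<open>C\<close> depending only on \<open>\<integral> |V|\<close>, and \<open>\<psi>(f)\<close> dominates
  \<open>f\<^sub>1\<^sup>2 + f\<^sub>2\<close> up to a factor 9. So the excess is positive for small \<open>\<theta>\<close>, uniformly in \<open>L\<close>.

  Convergence. If \<open>\<theta>\<close> exceeds the transition point of one torus, some \<open>f\<close> on that torus has
  negative excess. Repeating \<open>f\<close> in a block of \<open>n^d\<close> cells and continuing by 0 multiplies the
  excess by \<open>n^d\<close> up to a boundary term of lower order, so for one large \<open>n\<close> the excess is
  negative on every torus containing the block. Hence the transition points of all large
  tori are at most \<open>\<theta>\<close>, and they converge to their infimum. A negative Fourier coefficient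
  keeps them finite, through the perturbations \<open>cos (k \<cdot> x) / 2\<close> and \<open>sin (k \<cdot> x) / 2\<close>.

  All integrals are taken over the whole space with Lebesgue-Borel measure, for functions
  vanishing outside the half-open cell \<open>[0,L)^d\<close>; \<open>V\<close> is replaced by a Borel representative \<open>U\<close>.
\<close>

section \<open>The interaction form\<close>

lemma lborel_distr_minus:
  fixes x :: "'a::euclidean_space"
  shows "distr lborel borel (\<lambda>y. x - y) = (lborel :: 'a measure)"
  using lborel_affine[of "-1" x] by (simp add: density_1)

lemma integral_lborel_shift:
  fixes f :: "'a::euclidean_space \<Rightarrow> 'b::{banach,second_countable_topology}"
  assumes [measurable]: "f \<in> borel_measurable borel"
  shows "(\<integral>x. f (x - s) \<partial>lborel) = (\<integral>x. f x \<partial>lborel)"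
proof -
  have "(\<integral>x. f x \<partial>lborel) = (\<integral>x. f x \<partial>distr lborel borel ((+) (- s)))"
    by (simp only: lborel_distr_plus)
  also have "\<dots> = (\<integral>x. f (- s + x) \<partial>lborel)"
    by (subst integral_distr) auto
  finally show ?thesis by (simp add: algebra_simps)
qed

lemma integrable_lborel_shift:
  fixes f :: "'a::euclidean_space \<Rightarrow> 'b::{banach,second_countable_topology}"
  assumes "integrable lborel f"
  shows "integrable lborel (\<lambda>x. f (x - s))"
proof -
  have [measurable]: "f \<in> borel_measurable borel"
    using borel_measurable_integrable[OF assms] by simp
  have "integrable (distr lborel borel ((+) (- s))) f"
    using assms by (simp only: lborel_distr_plus)
  then show ?thesis
    by (subst (asm) integrable_distr_eq) (auto simp: algebra_simps)
qed

lemma integral_lborel_reflect: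
  fixes f :: "'a::euclidean_space \<Rightarrow> 'b::{banach,second_countable_topology}"
  assumes [measurable]: "f \<in> borel_measurable borel"
  shows "(\<integral>y. f (x - y) \<partial>lborel) = (\<integral>y. f y \<partial>lborel)"
proof -
  have "(\<integral>y. f y \<partial>lborel) = (\<integral>y. f y \<partial>distr lborel borel (\<lambda>y. x - y))"
    by (simp only: lborel_distr_minus)
  also have "\<dots> = (\<integral>y. f (x - y) \<partial>lborel)"
    by (subst integral_distr) auto
  finally show ?thesis by simp
qed

lemma AE_lborel_reflect:
  fixes P :: "'a::euclidean_space \<Rightarrow> bool"
  assumes "AE y in lborel. P y"
  shows "AE y in lborel. P (x - y)"
proof -
  obtain N where N: "N \<in> null_sets lborel" "{y. \<not> P y} \<subseteq> N"
    using assms by (auto simp: eventually_ae_filter)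
  have "AE y in distr lborel borel (\<lambda>y. x - y). y \<notin> N"
    using AE_not_in[OF N(1)] by (simp only: lborel_distr_minus)
  then have "AE y in lborel. x - y \<notin> N"
    using N(1) by (subst (asm) AE_distr_iff) (auto simp: null_sets_def)
  then show ?thesis using N(2) by (auto elim!: eventually_mono)
qed

text \<open>Taken over the product measure, so that linearity and invariance under diagonal
  translations need no iterated integrals. The torus interaction is recovered as
  \<open>pairing U g (wrap L g)\<close>.\<close>

definition pairing :: "(real^'n \<Rightarrow> real) \<Rightarrow> (real^'n \<Rightarrow> real) \<Rightarrow> (real^'n \<Rightarrow> real) \<Rightarrow> real" where
  "pairing U g h = (\<integral>p. U (fst p - snd p) * g (snd p) * h (fst p) \<partial>(lborel \<Otimes>\<^sub>M lborel))"

lemma integrable_lborel_imp_borel: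
  "integrable lborel f \<Longrightarrow> f \<in> borel_measurable borel"
  by (drule borel_measurable_integrable) simp

definition bounded_borel :: "(real^'n \<Rightarrow> real) \<Rightarrow> bool" where
  "bounded_borel U \<longleftrightarrow> U \<in> borel_measurable borel \<and> (\<exists>C. \<forall>x. \<bar>U x\<bar> \<le> C)"

lemma bounded_borel_measurable: "bounded_borel U \<Longrightarrow> U \<in> borel_measurable borel"
  by (simp add: bounded_borel_def)

lemma integrable_tensor:
  fixes g h :: "real^'n \<Rightarrow> real"
  assumes g: "integrable lborel g" and h: "integrable lborel h"
  shows "integrable (lborel \<Otimes>\<^sub>M lborel) (\<lambda>p. g (snd p) * h (fst p))"
proof (rule lborel_pair.Fubini_integrable)
  note [measurable] = g[THEN integrable_lborel_imp_borel] h[THEN integrable_lborel_imp_borel]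
  show "(\<lambda>p. g (snd p) * h (fst p)) \<in> borel_measurable (lborel \<Otimes>\<^sub>M lborel)"
    by measurable
  show "integrable lborel (\<lambda>x. \<integral>y. norm (g (snd (x, y)) * h (fst (x, y))) \<partial>lborel)"
    using g h by (simp add: abs_mult)
  show "AE x in lborel. integrable lborel (\<lambda>y. g (snd (x, y)) * h (fst (x, y)))"
    using g by simp
qed

lemma integrable_pairing:
  fixes g h :: "real^'n \<Rightarrow> real"
  assumes U: "bounded_borel U" and g: "integrable lborel g" and h: "integrable lborel h"
  shows "integrable (lborel \<Otimes>\<^sub>M lborel) (\<lambda>p. U (fst p - snd p) * g (snd p) * h (fst p))"
proof -
  note [measurable] = bounded_borel_measurable[OF U] g[THEN integrable_lborel_imp_borel]
    h[THEN integrable_lborel_imp_borel]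
  obtain C where C: "\<And>x. \<bar>U x\<bar> \<le> C" using U by (auto simp: bounded_borel_def)
  show ?thesis
  proof (rule Bochner_Integration.integrable_bound)
    show "integrable (lborel \<Otimes>\<^sub>M lborel) (\<lambda>p. C * (g (snd p) * h (fst p)))"
      using integrable_tensor[OF g h] by simp
    have "\<bar>U (fst p - snd p)\<bar> * \<bar>g (snd p) * h (fst p)\<bar> \<le> \<bar>C\<bar> * \<bar>g (snd p) * h (fst p)\<bar>" for p
      using C[of "fst p - snd p"] by (intro mult_right_mono) auto
    then show "AE p in lborel \<Otimes>\<^sub>M lborel. norm (U (fst p - snd p) * g (snd p) * h (fst p))
        \<le> norm (C * (g (snd p) * h (fst p)))"
      by (simp add: abs_mult mult.assoc)
  qed measurable
qed

lemma pairing_add_left: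
  assumes "bounded_borel U" "integrable lborel g" "integrable lborel g'" "integrable lborel h"
  shows "pairing U (\<lambda>x. g x + g' x) h = pairing U g h + pairing U g' h"
  unfolding pairing_def
  by (subst Bochner_Integration.integral_add[symmetric])
     (auto intro!: integrable_pairing assms Bochner_Integration.integral_cong simp: distrib_left distrib_right)

lemma pairing_add_right:
  assumes "bounded_borel U" "integrable lborel g" "integrable lborel h" "integrable lborel h'"
  shows "pairing U g (\<lambda>x. h x + h' x) = pairing U g h + pairing U g h'"
  unfolding pairing_def
  by (subst Bochner_Integration.integral_add[symmetric])
     (auto intro!: integrable_pairing assms Bochner_Integration.integral_cong simp: distrib_left distrib_right)

lemma pairing_scale_left: "pairing U (\<lambda>x. c * g x) h = c * pairing U g h"
  unfolding pairing_def
  by (subst Bochner_Integration.integral_mult_right_zero[symmetric]) (simp add: ac_simps)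

lemma pairing_scale_right: "pairing U g (\<lambda>x. c * h x) = c * pairing U g h"
  unfolding pairing_def
  by (subst Bochner_Integration.integral_mult_right_zero[symmetric]) (simp add: ac_simps)

lemma pairing_sum_left:
  assumes "bounded_borel U" "\<And>j. j \<in> J \<Longrightarrow> integrable lborel (g j)" "integrable lborel h"
  shows "pairing U (\<lambda>x. \<Sum>j\<in>J. g j x) h = (\<Sum>j\<in>J. pairing U (g j) h)"
  unfolding pairing_def
  by (subst Bochner_Integration.integral_sum[symmetric])
     (auto intro!: integrable_pairing assms Bochner_Integration.integral_cong
        simp: sum_distrib_left sum_distrib_right)

lemma pairing_sum_right:
  assumes "bounded_borel U" "\<And>j. j \<in> J \<Longrightarrow> integrable lborel (h j)" "integrable lborel g"
  shows "pairing U g (\<lambda>x. \<Sum>j\<in>J. h j x) = (\<Sum>j\<in>J. pairing U g (h j))"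
  unfolding pairing_def
  by (subst Bochner_Integration.integral_sum[symmetric])
     (auto intro!: integrable_pairing assms Bochner_Integration.integral_cong
        simp: sum_distrib_left sum_distrib_right)

text \<open>The kernel depends on \<open>x - y\<close> only and the product measure is invariant
  under the diagonal translation by \<open>(s, s)\<close>, so just the relative shift
  matters.\<close>

lemma pairing_shift:
  fixes g h :: "real^'n \<Rightarrow> real"
  assumes U: "bounded_borel U" and g: "integrable lborel g" and h: "integrable lborel h"
  shows "pairing U (\<lambda>x. g (x - s)) (\<lambda>x. h (x - t)) = pairing U g (\<lambda>x. h (x - (t - s)))"
proof -
  note [measurable] = bounded_borel_measurable[OF U] g[THEN integrable_lborel_imp_borel]
    h[THEN integrable_lborel_imp_borel]
  let ?F = "\<lambda>p. U (fst p - snd p) * g (snd p) * h (fst p - (t - s))"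
  have "pairing U (\<lambda>x. g (x - s)) (\<lambda>x. h (x - t)) = (\<integral>p. ?F (p - (s, s)) \<partial>lborel)"
    unfolding pairing_def lborel_prod by (auto intro!: Bochner_Integration.integral_cong simp: algebra_simps)
  also have "\<dots> = (\<integral>p. ?F p \<partial>lborel)"
    by (rule integral_lborel_shift) (simp add: borel_prod[symmetric])
  finally show ?thesis by (simp add: pairing_def lborel_prod)
qed

lemma pairing_Fubini:
  fixes g h :: "real^'n \<Rightarrow> real"
  assumes "bounded_borel U" "integrable lborel g" "integrable lborel h"
  shows "pairing U g h = (\<integral>x. (\<integral>y. U (x - y) * g y \<partial>lborel) * h x \<partial>lborel)"
    and "pairing U g h = (\<integral>y. (\<integral>x. U (x - y) * h x \<partial>lborel) * g y \<partial>lborel)"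
proof -
  have i: "integrable (lborel \<Otimes>\<^sub>M lborel) (\<lambda>(x,y). U (x - y) * g y * h x)"
    using integrable_pairing[OF assms] by (simp only: case_prod_unfold)
  have e: "pairing U g h = (\<integral>p. (case p of (x,y) \<Rightarrow> U (x - y) * g y * h x) \<partial>(lborel \<Otimes>\<^sub>M lborel))"
    unfolding pairing_def by (simp add: case_prod_beta)
  show "pairing U g h = (\<integral>x. (\<integral>y. U (x - y) * g y \<partial>lborel) * h x \<partial>lborel)"
    using lborel_pair.integral_fst[OF i] by (simp only: e integral_mult_left_zero)
  have "(\<integral>x. U (x - y) * g y * h x \<partial>lborel) = (\<integral>x. U (x - y) * h x \<partial>lborel) * g y" for y
    by (subst integral_mult_left_zero[symmetric]) (simp add: ac_simps)
  then show "pairing U g h = (\<integral>y. (\<integral>x. U (x - y) * h x \<partial>lborel) * g y \<partial>lborel)"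
    using lborel_pair.integral_snd[OF i] by (simp only: e)
qed

section \<open>Wrapping around the torus\<close>

definition lat :: "real \<Rightarrow> int^'n \<Rightarrow> real^'n" where
  "lat L m = (\<chi> i. L * of_int (m $ i))"

definition neighbours :: "(int^'n) set" where
  "neighbours = {m. \<forall>i. m $ i \<in> {-1, 0, 1}}"

text \<open>Half-open, unlike the closed \<open>torus_box\<close>, so that the lattice translates
  partition the space; the two sets differ by a null set.\<close>

definition cell :: "real \<Rightarrow> (real^'n) set" where
  "cell L = {x. \<forall>i. 0 \<le> x $ i \<and> x $ i < L}"

text \<open>The kernels have range less than \<open>L\<close>, so only the neighbouring periodic images
  contribute to interactions with a point of the cell.\<close>

definition wrap :: "real \<Rightarrow> (real^'n \<Rightarrow> real) \<Rightarrow> real^'n \<Rightarrow> real" where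
  "wrap L h x = (\<Sum>m\<in>neighbours. h (x - lat L m))"

lemma finite_card_vec_box:
  fixes S :: "'b set"
  assumes "finite S"
  shows "finite {m::'b^'n. \<forall>i. m $ i \<in> S}" "card {m::'b^'n. \<forall>i. m $ i \<in> S} = card S ^ CARD('n)"
proof -
  have eq: "{m::'b^'n. \<forall>i. m $ i \<in> S} = vec_lambda ` (Pi\<^sub>E UNIV (\<lambda>_. S))"
  proof safe
    fix m :: "'b^'n" assume "\<forall>i. m $ i \<in> S"
    then show "m \<in> vec_lambda ` (Pi\<^sub>E UNIV (\<lambda>_. S))"
      by (intro image_eqI[of _ _ "vec_nth m"]) auto
  qed (auto simp: PiE_def)
  have inj: "inj_on vec_lambda (Pi\<^sub>E UNIV (\<lambda>_. S) :: ('n \<Rightarrow> 'b) set)"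
    by (rule inj_onI) (metis vec_lambda_inverse UNIV_I)
  show "finite {m::'b^'n. \<forall>i. m $ i \<in> S}"
    unfolding eq using assms by (intro finite_imageI finite_PiE) auto
  show "card {m::'b^'n. \<forall>i. m $ i \<in> S} = card S ^ CARD('n)"
    unfolding eq card_image[OF inj] by (simp add: card_PiE)
qed

lemma finite_neighbours [simp]: "finite neighbours"
  unfolding neighbours_def by (rule finite_card_vec_box) simp

lemma uminus_neighbours: "bij_betw uminus neighbours (neighbours :: (int^'n) set)"
proof (rule bij_betwI[where g = uminus])
  show "uminus \<in> neighbours \<rightarrow> (neighbours :: (int^'n) set)"
    by (auto simp: neighbours_def)
  then show "uminus \<in> neighbours \<rightarrow> (neighbours :: (int^'n) set)" .
qed auto

lemma lat_nth [simp]: "lat L m $ i = L * of_int (m $ i)"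
  by (simp add: lat_def)

lemma lat_uminus: "lat L (- m) = - lat L m"
  by (simp add: vec_eq_iff)

lemma measurable_cell [measurable]: "cell L \<in> sets borel"
proof -
  have "cell L = (\<Inter>i. {x. 0 \<le> x $ i} \<inter> {x. x $ i < L})"
    by (auto simp: cell_def)
  also have "\<dots> \<in> sets borel"
    by (intro sets.finite_INT sets.Int borel_closed borel_open closed_Collect_le open_Collect_less
        continuous_intros) auto
  finally show ?thesis .
qed

lemma shift_cell_iff:
  assumes "0 < L"
  shows "x - lat L m \<in> cell L \<longleftrightarrow> m = (\<chi> i. \<lfloor>x $ i / L\<rfloor>)"
proof -
  have "0 \<le> x $ i - L * of_int (m $ i) \<and> x $ i - L * of_int (m $ i) < L \<longleftrightarrow> m $ i = \<lfloor>x $ i / L\<rfloor>" for i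
    using assms by (auto simp: floor_eq_iff eq_commute[of "m $ i"] field_simps)
  then show ?thesis by (simp add: cell_def vec_eq_iff)
qed

lemma torus_box_cell: "torus_box L \<supseteq> cell L"
  by (auto simp: torus_box_def cell_def mem_box_cart less_imp_le)

lemma box_subset_cell: "box 0 (\<chi> i. L) \<subseteq> cell L"
  by (auto simp: cell_def mem_box_cart less_imp_le)

lemma AE_torus_box_cell: "AE x in lborel. x \<in> torus_box L \<longrightarrow> x \<in> cell L"
proof (rule AE_I)
  show "{x \<in> space lborel. \<not> (x \<in> torus_box L \<longrightarrow> x \<in> cell L)} \<subseteq> cbox 0 (\<chi> i. L) - box 0 (\<chi> i. L)"
    using box_subset_cell by (auto simp: torus_box_def)
  show "emeasure lborel (cbox 0 (\<chi> i. L) - box 0 (\<chi> i. L)) = 0"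
    by (subst emeasure_Diff) (auto simp: emeasure_lborel_box_eq emeasure_lborel_cbox_eq box_subset_cbox)
qed auto

lemma measure_torus_box: "0 \<le> L \<Longrightarrow> measure lborel (torus_box L :: (real^'n) set) = L ^ CARD('n)"
  unfolding torus_box_def
  by (subst measure_lborel_cbox_eq) (auto simp: cart_eq_inner_axis[symmetric] prod_constant inner_axis Basis_vec_def prod.UNION_disjoint axis_eq_axis)

lemma measure_cell: "0 \<le> L \<Longrightarrow> measure lborel (cell L :: (real^'n) set) = L ^ CARD('n)"
  using AE_torus_box_cell[of L] torus_box_cell[of L] measure_torus_box[of L]
  by (subst measure_eq_AE[of _ "torus_box L"]) (auto simp: torus_box_def elim!: eventually_mono)

lemma emeasure_cell_finite: "emeasure lborel (cell L) < \<infinity>"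
  by (rule le_less_trans[OF emeasure_mono[OF torus_box_cell]])
    (auto simp: torus_box_def emeasure_lborel_cbox_eq)

lemma integrable_indicator_cell [simp]: "integrable lborel (indicator (cell L) :: _ \<Rightarrow> real)"
  using emeasure_cell_finite by (intro integrable_real_indicator) auto

lemma integrable_wrap:
  "integrable lborel h \<Longrightarrow> integrable lborel (wrap L h)"
  unfolding wrap_def by (intro Bochner_Integration.integrable_sum integrable_lborel_shift)

text \<open>Exactly one lattice translate of the cell contains \<open>x\<close>, and the bounds on
  \<open>x\<close> force its index, the coordinatewise floor of \<open>x / L\<close>, into
  \<open>neighbours\<close>.\<close>

lemma wrap_indicator:
  assumes "0 < L" "\<And>i. - L \<le> x $ i" "\<And>i. x $ i < 2 * L"
  shows "wrap L (indicator (cell L)) x = 1"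
proof -
  define m where "m = (\<chi> i. \<lfloor>x $ i / L\<rfloor>)"
  have "-1 \<le> m $ i \<and> m $ i \<le> 1" for i
    using assms(1) assms(2)[of i] assms(3)[of i]
    by (auto simp: m_def le_floor_iff floor_le_iff field_simps)
  then have "m \<in> neighbours" unfolding neighbours_def by (auto, smt (verit))
  have "wrap L (indicator (cell L)) x = (\<Sum>m'\<in>neighbours. if m' = m then 1 else 0)"
    unfolding wrap_def by (intro sum.cong) (auto simp: indicator_def shift_cell_iff[OF assms(1)] m_def)
  then show ?thesis using \<open>m \<in> neighbours\<close> by simp
qed

text \<open>Moving the translation by \<open>lat L m\<close> from \<open>h\<close> to
  \<open>g\<close> reverses its sign, and \<open>neighbours\<close> is symmetric under
  negation.\<close>

lemma pairing_wrap_swap: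
  assumes "bounded_borel U" "integrable lborel g" "integrable lborel h"
  shows "pairing U g (wrap L h) = pairing U (wrap L g) h"
proof -
  have "pairing U g (wrap L h) = (\<Sum>m\<in>neighbours. pairing U g (\<lambda>x. h (x - lat L m)))"
    unfolding wrap_def using assms by (intro pairing_sum_right integrable_lborel_shift)
  also have "\<dots> = (\<Sum>m\<in>neighbours. pairing U (\<lambda>x. g (x - lat L (- m))) (\<lambda>x. h (x - 0)))"
    by (subst pairing_shift[OF assms]) (simp add: lat_uminus)
  also have "\<dots> = (\<Sum>m\<in>neighbours. pairing U (\<lambda>x. g (x - lat L m)) h)"
    by (subst sum.reindex_bij_betw[OF uminus_neighbours, symmetric]) simp
  also have "\<dots> = pairing U (wrap L g) h"
    unfolding wrap_def using assms by (intro pairing_sum_left[symmetric] integrable_lborel_shift)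
  finally show ?thesis .
qed

section \<open>Kernels of finite range and the uniform density\<close>

definition short_range :: "real \<Rightarrow> (real^'n \<Rightarrow> real) \<Rightarrow> bool" where
  "short_range a U \<longleftrightarrow> bounded_borel U \<and> (\<forall>z. a < norm z \<longrightarrow> U z = 0)"

lemma short_rangeD:
  assumes "short_range a U"
  shows "bounded_borel U" "a < norm z \<Longrightarrow> U z = 0"
  using assms by (auto simp: short_range_def)

lemma short_range_integrable:
  assumes "short_range a U"
  shows "integrable lborel U"
proof -
  note [measurable] = bounded_borel_measurable[OF short_rangeD(1)[OF assms]]
  obtain C where C: "\<And>x. \<bar>U x\<bar> \<le> C"
    using short_rangeD(1)[OF assms] by (auto simp: bounded_borel_def)
  show ?thesis
  proof (rule Bochner_Integration.integrable_bound)
    show "integrable lborel (\<lambda>x. C * indicator (cball 0 a) x)"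
      by (intro integrable_mult_right integrable_real_indicator) (use emeasure_lborel_cball_finite in auto)
    have "norm (U x) \<le> norm (C * indicator (cball 0 a) x)" for x
      using C[of x] short_rangeD(2)[OF assms, of x] by (auto simp: indicator_def not_le)
    then show "AE x in lborel. norm (U x) \<le> norm (C * indicator (cball 0 a) x)"
      by simp
  qed auto
qed

lemma short_range_abs: "short_range a U \<Longrightarrow> short_range a (\<lambda>z. \<bar>U z\<bar>)"
  by (auto simp: short_range_def bounded_borel_def)

lemma wrap_near:
  assumes "a < L" "0 \<le> a" "y \<in> cell L" "norm (x - y) \<le> a"
  shows "wrap L (indicator (cell L)) x = 1"
proof (rule wrap_indicator)
  fix i
  have "\<bar>x $ i - y $ i\<bar> \<le> a" using component_le_norm_cart[of "x - y" i] assms(4) by simp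
  then show "- L \<le> x $ i" "x $ i < 2 * L"
    using assms by (auto simp: cell_def dest!: spec[of _ i])
qed (use assms in auto)

text \<open>For \<open>y\<close> in the cell, the kernel centred at \<open>y\<close> meets only
  points where the wrapped indicator is 1, so the inner integral is the full integral of
  \<open>U\<close>. Hence a mean-zero function does not interact with the uniform density.\<close>

lemma pairing_wrap_cell_right:
  assumes U: "short_range a U" and L: "a < L" "0 \<le> a"
    and g: "integrable lborel g" "\<And>x. x \<notin> cell L \<Longrightarrow> g x = 0"
  shows "pairing U g (wrap L (indicator (cell L))) = (\<integral>x. U x \<partial>lborel) * (\<integral>x. g x \<partial>lborel)"
proof -
  note [measurable] = bounded_borel_measurable[OF short_rangeD(1)[OF U]]
  have "(\<integral>x. U (x - y) * wrap L (indicator (cell L)) x \<partial>lborel) * g y = (\<integral>x. U x \<partial>lborel) * g y" for y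
  proof (cases "y \<in> cell L")
    case True
    have "U (x - y) * wrap L (indicator (cell L)) x = U (x - y)" for x
      using wrap_near[OF L True, of x] short_rangeD(2)[OF U, of "x - y"] by (cases "norm (x - y) \<le> a") auto
    then show ?thesis by (simp only: integral_lborel_shift[OF bounded_borel_measurable[OF short_rangeD(1)[OF U]]])
  qed (simp add: g)
  then have "(\<integral>y. (\<integral>x. U (x - y) * wrap L (indicator (cell L)) x \<partial>lborel) * g y \<partial>lborel)
      = (\<integral>x. U x \<partial>lborel) * (\<integral>x. g x \<partial>lborel)"
    by (simp only: integral_mult_right_zero)
  then show ?thesis
    by (subst pairing_Fubini(2)) (auto intro!: short_rangeD(1)[OF U] g integrable_wrap)
qed

text \<open>Once the wrap is moved onto the indicator, this is the mirror image of
  \<open>pairing_wrap_cell_right\<close>, integrating over \<open>y\<close> first.\<close>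

lemma pairing_wrap_cell_left:
  assumes U: "short_range a U" and L: "a < L" "0 \<le> a"
    and h: "integrable lborel h" "\<And>x. x \<notin> cell L \<Longrightarrow> h x = 0"
  shows "pairing U (indicator (cell L)) (wrap L h) = (\<integral>x. U x \<partial>lborel) * (\<integral>x. h x \<partial>lborel)"
proof -
  note [measurable] = bounded_borel_measurable[OF short_rangeD(1)[OF U]]
  have "(\<integral>y. U (x - y) * wrap L (indicator (cell L)) y \<partial>lborel) * h x = (\<integral>y. U y \<partial>lborel) * h x" for x
  proof (cases "x \<in> cell L")
    case True
    have "U (x - y) * wrap L (indicator (cell L)) y = U (x - y)" for y
      using wrap_near[OF L True, of y] short_rangeD(2)[OF U, of "x - y"]
      by (cases "norm (x - y) \<le> a") (auto simp: norm_minus_commute)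
    then show ?thesis by (simp only: integral_lborel_reflect[OF bounded_borel_measurable[OF short_rangeD(1)[OF U]]])
  qed (simp add: h)
  then have "(\<integral>x. (\<integral>y. U (x - y) * wrap L (indicator (cell L)) y \<partial>lborel) * h x \<partial>lborel)
      = (\<integral>x. U x \<partial>lborel) * (\<integral>x. h x \<partial>lborel)"
    by (simp only: integral_mult_right_zero)
  then show ?thesis
    by (subst pairing_wrap_swap, (auto intro!: short_rangeD(1)[OF U] h)[3], subst pairing_Fubini(1))
       (auto intro!: short_rangeD(1)[OF U] h integrable_wrap)
qed

section \<open>Lower bound for the excess\<close>

definition psi :: "real \<Rightarrow> real" where
  "psi t = (1 + t) * ln (1 + t) - t"

lemma psi_0 [simp]: "psi 0 = 0"
  by (simp add: psi_def)

text \<open>A Hellinger-type bound. With \<open>s = sqrt (1 + t)\<close> one has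
  \<open>psi t = 2 * s\<^sup>2 * ln s - s\<^sup>2 + 1\<close>, and
  \<open>ln s \<ge> 1 - 1 / s\<close> bounds this below by \<open>(s - 1)\<^sup>2\<close>.\<close>

lemma psi_ge:
  assumes "- 1 \<le> t"
  shows "(sqrt (1 + t) - 1)\<^sup>2 \<le> psi t"
proof (cases "t = - 1")
  case True
  then show ?thesis by (simp add: psi_def)
next
  case False
  define s where "s = sqrt (1 + t)"
  have s: "0 < s" "1 + t = s\<^sup>2" using assms False by (auto simp: s_def)
  have "ln (1 / s) \<le> 1 / s - 1" using s by (intro ln_le_minus_one) auto
  then have "s\<^sup>2 * (2 * (1 - 1 / s)) \<le> s\<^sup>2 * (2 * ln s)"
    using s by (intro mult_left_mono) (auto simp: ln_div)
  moreover have "psi t = s\<^sup>2 * (2 * ln s) - s\<^sup>2 + 1"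
    using s by (simp add: psi_def ln_realpow)
  moreover have "s\<^sup>2 * (2 * (1 - 1 / s)) = 2 * s\<^sup>2 - 2 * s"
    using s by (simp add: field_simps power2_eq_square)
  ultimately show ?thesis
    unfolding s_def[symmetric] power2_diff by simp
qed

lemma psi_nonneg: "- 1 \<le> t \<Longrightarrow> 0 \<le> psi t"
  using psi_ge[of t] by (smt (verit) zero_le_power2)

lemma psi_eq_0_iff: "- 1 \<le> t \<Longrightarrow> psi t = 0 \<longleftrightarrow> t = 0"
  using psi_ge[of t] by (smt (verit) psi_0 zero_less_power2 real_sqrt_eq_1_iff)

text \<open>In terms of \<open>s = sqrt (1 + t)\<close>, \<open>t = (s - 1) * (s + 1)\<close> with
  \<open>s + 1 \<le> 3\<close>; the square of 3 is the constant.\<close>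

lemma psi_ge_square:
  assumes "- 1 \<le> t" "t \<le> 3"
  shows "t\<^sup>2 \<le> 9 * psi t"
proof -
  define s where "s = sqrt (1 + t)"
  have "s \<le> sqrt (2\<^sup>2)" unfolding s_def using assms by (intro real_sqrt_le_mono) auto
  then have s: "0 \<le> s" "s \<le> 2" "t = s\<^sup>2 - 1" using assms by (auto simp: s_def)
  have "t\<^sup>2 = (s - 1)\<^sup>2 * (s + 1)\<^sup>2" unfolding s(3) by (simp add: power2_eq_square algebra_simps)
  also have "\<dots> \<le> (s - 1)\<^sup>2 * 3\<^sup>2" using s by (intro mult_left_mono power_mono) auto
  finally show ?thesis using psi_ge[OF assms(1)] by (simp add: s_def)
qed

text \<open>In the same variable \<open>3 * (s - 1)\<^sup>2 - t = 2 * (s - 1) * (s - 2)\<close>,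
  which is nonnegative once \<open>s \<ge> 2\<close>, that is \<open>t \<ge> 3\<close>. This fixes
  the height at which \<open>f\<close> is cut.\<close>

lemma psi_ge_linear:
  assumes "3 \<le> t"
  shows "t \<le> 3 * psi t"
proof -
  define s where "s = sqrt (1 + t)"
  have "sqrt (2\<^sup>2) \<le> s" unfolding s_def using assms by (intro real_sqrt_le_mono) auto
  then have s: "2 \<le> s" "t = s\<^sup>2 - 1" using assms by (auto simp: s_def)
  have "0 \<le> 2 * ((s - 1) * (s - 2))" using s by (intro mult_nonneg_nonneg) auto
  then have "t \<le> 3 * (s - 1)\<^sup>2" unfolding s(2) by (simp add: power2_eq_square algebra_simps)
  then show ?thesis using psi_ge[of t] assms by (simp add: s_def)
qed

lemma borel_measurable_psi [measurable]: "psi \<in> borel_measurable borel"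
  unfolding psi_def by measurable

text \<open>The relative deviation from the uniform density. The last conjunct encodes finite
  entropy: densities of infinite free energy cannot compete with \<open>rho0\<close>.\<close>

definition perturbation :: "real \<Rightarrow> (real^'n \<Rightarrow> real) \<Rightarrow> bool" where
  "perturbation L f \<longleftrightarrow> integrable lborel f \<and> (\<integral>x. f x \<partial>lborel) = 0 \<and> (\<forall>x. x \<notin> cell L \<longrightarrow> f x = 0)
     \<and> (\<forall>x. - 1 \<le> f x) \<and> integrable lborel (\<lambda>x. psi (f x))"

lemma bounded_borel_abs: "bounded_borel U \<Longrightarrow> bounded_borel (\<lambda>z. \<bar>U z\<bar>)"
  by (auto simp: bounded_borel_def)

text \<open>The majorant is the mean of two products: this fits the inequality of arithmetic and
  geometric means, and a single product is covered by listing it twice.\<close>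

lemma pairing_bound:
  assumes U: "bounded_borel U"
    and i: "integrable lborel g" "integrable lborel h" "integrable lborel G" "integrable lborel k"
      "integrable lborel l" "integrable lborel H"
    and le: "\<And>x y. \<bar>g y * h x\<bar> \<le> (G y * k x + l y * H x) / 2"
  shows "\<bar>pairing U g h\<bar> \<le> (pairing (\<lambda>z. \<bar>U z\<bar>) G k + pairing (\<lambda>z. \<bar>U z\<bar>) l H) / 2"
proof -
  let ?F = "\<lambda>g h p. \<bar>U (fst p - snd p)\<bar> * g (snd p) * h (fst p)"
  note iG = integrable_pairing[OF bounded_borel_abs[OF U] i(3,4)]
  note il = integrable_pairing[OF bounded_borel_abs[OF U] i(5,6)]
  have "\<bar>pairing U g h\<bar> \<le> (\<integral>p. \<bar>U (fst p - snd p) * g (snd p) * h (fst p)\<bar> \<partial>(lborel \<Otimes>\<^sub>M lborel))"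
    unfolding pairing_def by (rule integral_abs_bound)
  also have "\<dots> \<le> (\<integral>p. (?F G k p + ?F l H p) / 2 \<partial>(lborel \<Otimes>\<^sub>M lborel))"
  proof (rule integral_mono)
    fix p
    have "\<bar>U (fst p - snd p)\<bar> * \<bar>g (snd p) * h (fst p)\<bar>
        \<le> \<bar>U (fst p - snd p)\<bar> * ((G (snd p) * k (fst p) + l (snd p) * H (fst p)) / 2)"
      by (intro mult_left_mono le) auto
    then show "\<bar>U (fst p - snd p) * g (snd p) * h (fst p)\<bar> \<le> (?F G k p + ?F l H p) / 2"
      by (simp add: abs_mult algebra_simps)
  qed (use integrable_pairing[OF U i(1,2)] iG il in auto)
  also have "\<dots> = (pairing (\<lambda>z. \<bar>U z\<bar>) G k + pairing (\<lambda>z. \<bar>U z\<bar>) l H) / 2"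
    unfolding pairing_def using iG il by simp
  finally show ?thesis .
qed

lemma wrap_mono: "(\<And>x. g x \<le> h x) \<Longrightarrow> wrap L g x \<le> wrap L h x"
  unfolding wrap_def by (rule sum_mono) 

lemma wrap_scale: "wrap L (\<lambda>x. c * h x) = (\<lambda>x. c * wrap L h x)"
  by (auto simp: wrap_def sum_distrib_left)

lemma wrap_add: "wrap L (\<lambda>x. g x + h x) = (\<lambda>x. wrap L g x + wrap L h x)"
  by (auto simp: wrap_def sum.distrib)

lemma abs_wrap_le: "\<bar>wrap L h x\<bar> \<le> wrap L (\<lambda>x. \<bar>h x\<bar>) x"
  unfolding wrap_def by (rule sum_abs)

text \<open>Let \<open>A\<close> be the integral of \<open>\<bar>U\<bar>\<close>. The
  self-interaction of \<open>f1\<close> costs at most \<open>A\<close> times the integral of its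
  square, and since \<open>\<bar>f1\<bar> \<le> 3\<close> each cross term at most
  \<open>3 * A\<close> times the integral of \<open>f2\<close>. These bounds do not see
  \<open>L\<close>, because the wrapped cell indicator is 1 near the cell. The self-interaction of
  \<open>f2\<close> is nonnegative by \<open>K\<close>.\<close>

lemma interaction_lower_bound:
  fixes f :: "real^'n \<Rightarrow> real"
  assumes U: "short_range a U" and L: "a < L" "0 \<le> a"
    and K: "\<And>g. integrable lborel g \<Longrightarrow> (\<And>x. 0 \<le> g x) \<Longrightarrow> (\<And>x. x \<notin> cell L \<Longrightarrow> g x = 0)
        \<Longrightarrow> 0 \<le> pairing U g (wrap L g)"
    and f: "perturbation L f"
  shows "pairing U f (wrap L f) \<ge> - (18 * (\<integral>z. \<bar>U z\<bar> \<partial>lborel) * (\<integral>x. psi (f x) \<partial>lborel))"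
proof -
  define A where "A = (\<integral>z. \<bar>U z\<bar> \<partial>lborel)"
  have A: "0 \<le> A" by (simp add: A_def)
  define f1 where "f1 x = (if f x \<le> 3 then f x else 0)" for x
  define f2 where "f2 x = (if f x \<le> 3 then 0 else f x)" for x
  let ?c = "indicator (cell L) :: real^'n \<Rightarrow> real"
  have fi: "integrable lborel f" "integrable lborel (\<lambda>x. psi (f x))"
    and f0: "\<And>x. x \<notin> cell L \<Longrightarrow> f x = 0" and fm: "\<And>x. - 1 \<le> f x"
    using f by (auto simp: perturbation_def)
  have [measurable]: "f \<in> borel_measurable borel" using fi(1) by (rule integrable_lborel_imp_borel)
  have [measurable]: "f1 \<in> borel_measurable borel" "f2 \<in> borel_measurable borel"
    unfolding f1_def f2_def by measurable
  have split: "f = (\<lambda>x. f1 x + f2 x)" by (auto simp: f1_def f2_def)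
  have i1: "integrable lborel f1" and i2: "integrable lborel f2"
    by (rule Bochner_Integration.integrable_bound[OF fi(1)], auto simp: f1_def f2_def)+
  have s1: "(f1 x)\<^sup>2 + f2 x \<le> 9 * psi (f x)" for x
    using psi_ge_square[OF fm[of x]] psi_ge_linear[of "f x"] psi_nonneg[OF fm[of x]]
    by (auto simp: f1_def f2_def)
  have f2n: "0 \<le> f2 x" for x by (auto simp: f2_def)
  have iq: "integrable lborel (\<lambda>x. (f1 x)\<^sup>2)"
  proof (rule Bochner_Integration.integrable_bound)
    show "integrable lborel (\<lambda>x. 9 * psi (f x))" using fi by simp
    have "norm ((f1 x)\<^sup>2) \<le> norm (9 * psi (f x))" for x using s1[of x] f2n[of x] by simp
    then show "AE x in lborel. norm ((f1 x)\<^sup>2) \<le> norm (9 * psi (f x))" by simp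
  qed measurable
  have z1: "x \<notin> cell L \<Longrightarrow> f1 x = 0" and z2: "x \<notin> cell L \<Longrightarrow> f2 x = 0" for x
    by (auto simp: f1_def f2_def f0)
  have b1: "\<bar>f1 x\<bar> \<le> 3 * ?c x" for x
    using z1[of x] fm[of x] by (cases "x \<in> cell L") (auto simp: f1_def)
  note Ub = short_rangeD(1)[OF U]
  note sA = short_range_abs[OF U]
  have w: "\<bar>pairing U f1 (wrap L f1)\<bar> \<le> A * (\<integral>x. (f1 x)\<^sup>2 \<partial>lborel)"
  proof -
    \<comment> \<open>The inequality of arithmetic and geometric means is applied to each periodic
      image. The cell indicators, free because \<open>f1\<close> vanishes off the cell, keep the
      majorants integrable.\<close>
    have "\<bar>f1 y * wrap L f1 x\<bar> \<le> ((f1 y)\<^sup>2 * wrap L ?c x + ?c y * wrap L (\<lambda>x. (f1 x)\<^sup>2) x) / 2" for x y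
    proof -
      have am: "\<bar>f1 y * f1 v\<bar> \<le> ((f1 y)\<^sup>2 * ?c v + ?c y * (f1 v)\<^sup>2) / 2" for v
      proof (cases "y \<in> cell L \<and> v \<in> cell L")
        case True
        have "0 \<le> (\<bar>f1 y\<bar> - \<bar>f1 v\<bar>)\<^sup>2" by simp
        then show ?thesis using True by (simp add: power2_diff abs_mult)
      qed (use z1 in auto)
      have "\<bar>f1 y * wrap L f1 x\<bar> \<le> (\<Sum>m\<in>neighbours. \<bar>f1 y * f1 (x - lat L m)\<bar>)"
        unfolding wrap_def sum_distrib_left by (rule sum_abs)
      also have "\<dots> \<le> (\<Sum>m\<in>neighbours. ((f1 y)\<^sup>2 * ?c (x - lat L m) + ?c y * (f1 (x - lat L m))\<^sup>2) / 2)"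
        by (intro sum_mono am)
      also have "\<dots> = ((f1 y)\<^sup>2 * wrap L ?c x + ?c y * wrap L (\<lambda>x. (f1 x)\<^sup>2) x) / 2"
        by (simp add: wrap_def sum_distrib_left sum.distrib flip: sum_divide_distrib)
      finally show ?thesis .
    qed
    from pairing_bound[OF Ub i1 integrable_wrap[OF i1] iq integrable_wrap _ integrable_wrap[OF iq] this]
    show ?thesis
      using pairing_wrap_cell_right[OF sA L iq] pairing_wrap_cell_left[OF sA L iq] z1 by (simp add: A_def)
  qed
  have w12: "\<bar>pairing U f1 (wrap L f2)\<bar> \<le> 3 * A * (\<integral>x. f2 x \<partial>lborel)"
  proof -
    have "\<bar>f1 y * wrap L f2 x\<bar> \<le> (3 * ?c y * wrap L f2 x + 3 * ?c y * wrap L f2 x) / 2" for x y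
      using mult_right_mono[OF b1[of y], of "\<bar>wrap L f2 x\<bar>"] f2n
      by (simp add: abs_mult wrap_def sum_nonneg)
    from pairing_bound[OF Ub i1 integrable_wrap[OF i2] _ integrable_wrap[OF i2] _ integrable_wrap[OF i2] this]
    show ?thesis
      using pairing_wrap_cell_left[OF sA L i2] z2 by (simp add: A_def pairing_scale_left ac_simps)
  qed
  have w21: "\<bar>pairing U f2 (wrap L f1)\<bar> \<le> 3 * A * (\<integral>x. f2 x \<partial>lborel)"
  proof -
    have "\<bar>f2 y * wrap L f1 x\<bar> \<le> (f2 y * (3 * wrap L ?c x) + f2 y * (3 * wrap L ?c x)) / 2" for x y
    proof -
      have "\<bar>wrap L f1 x\<bar> \<le> 3 * wrap L ?c x"
        using abs_wrap_le[of L f1 x] wrap_mono[of "\<lambda>x. \<bar>f1 x\<bar>" "\<lambda>x. 3 * ?c x" L x, OF b1] by (simp add: wrap_scale)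
      from mult_left_mono[OF this f2n[of y]] show ?thesis using f2n[of y] by (simp add: abs_mult)
    qed
    from pairing_bound[OF Ub i2 integrable_wrap[OF i1] i2 _ i2 _ this]
    show ?thesis
      using pairing_wrap_cell_right[OF sA L i2] z2 by (simp add: A_def pairing_scale_right integrable_wrap ac_simps)
  qed
  have "pairing U f (wrap L f) = pairing U f1 (wrap L f1) + pairing U f1 (wrap L f2)
      + pairing U f2 (wrap L f1) + pairing U f2 (wrap L f2)"
    unfolding split wrap_add
    by (simp add: pairing_add_left pairing_add_right Ub i1 i2 integrable_wrap)
  moreover have "0 \<le> pairing U f2 (wrap L f2)"
    by (rule K[OF i2 f2n z2])
  ultimately have "- pairing U f (wrap L f) \<le> A * (\<integral>x. (f1 x)\<^sup>2 \<partial>lborel) + 6 * A * (\<integral>x. f2 x \<partial>lborel)"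
    using w w12 w21 by linarith
  also have "\<dots> = A * (\<integral>x. (f1 x)\<^sup>2 + 6 * f2 x \<partial>lborel)"
    using i2 iq by (simp add: algebra_simps)
  also have "\<dots> \<le> A * (\<integral>x. 18 * psi (f x) \<partial>lborel)"
  proof (intro mult_left_mono integral_mono A)
    fix x
    \<comment> \<open>Where \<open>f x \<le> 3\<close> only the square is present and costs 9; where
      \<open>f x > 3\<close>, six times the linear bound gives 18.\<close>
    show "(f1 x)\<^sup>2 + 6 * f2 x \<le> 18 * psi (f x)"
      using psi_ge_square[OF fm[of x]] psi_ge_linear[of "f x"] psi_nonneg[OF fm[of x]]
      by (auto simp: f1_def f2_def)
  qed (use i2 iq fi in auto)
  finally show ?thesis by (simp add: A_def)
qed

section \<open>Tiling\<close>

definition block :: "nat \<Rightarrow> (int^'n) set" where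
  "block n = {j. \<forall>i. j $ i \<in> {0..<int n}}"

definition tiled :: "nat \<Rightarrow> real \<Rightarrow> (real^'n \<Rightarrow> real) \<Rightarrow> real^'n \<Rightarrow> real" where
  "tiled n L f x = (\<Sum>j\<in>block n. f (x - lat L j))"

lemma finite_block [simp]: "finite (block n :: (int^'n) set)"
  and card_block: "card (block n :: (int^'n) set) = n ^ CARD('n)"
  using finite_card_vec_box[of "{0..<int n}", where 'n='n] by (simp_all add: block_def del: atLeastLessThan_iff)

lemma zero_neighbours: "0 \<in> neighbours"
  by (simp add: neighbours_def)

text \<open>The translates have disjoint supports, so every map fixing 0 commutes with the sum.\<close>

lemma tiled_apply:
  fixes F :: "real \<Rightarrow> real"
  assumes "0 < L" "\<And>x. x \<notin> cell L \<Longrightarrow> f x = 0" "F 0 = 0"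
  shows "F (tiled n L f x) = (\<Sum>j\<in>block n. F (f (x - lat L j)))"
proof -
  define m where "m = (\<chi> i. \<lfloor>x $ i / L\<rfloor>)"
  have e: "G (f (x - lat L j)) = (if j = m then G (f (x - lat L m)) else 0)" if "G 0 = 0" for G :: "real \<Rightarrow> real" and j
    using assms(2)[of "x - lat L j"] shift_cell_iff[OF assms(1), of x j] that by (auto simp: m_def)
  \<comment> \<open>Used for \<open>F\<close> and for the identity, so that both sides reduce to the
    single cell containing \<open>x\<close>.\<close>
  have s: "(\<Sum>j\<in>block n. G (f (x - lat L j))) = (if m \<in> block n then G (f (x - lat L m)) else 0)"
    if "G 0 = 0" for G :: "real \<Rightarrow> real"
    by (subst e[of G, OF that]) simp
  show ?thesis using s[of F] s[of "\<lambda>t. t"] assms(3) by (simp add: tiled_def)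
qed

text \<open>Disjoint supports make the entropy exactly additive over the cells. Mean zero on each
  cell keeps the mean zero after continuation by 0 to a larger torus.\<close>

lemma perturbation_tiled:
  assumes L: "0 < L" "real n * L \<le> L'" and f: "perturbation L f"
  shows "perturbation L' (tiled n L (f :: real^'n \<Rightarrow> real))"
    and "(\<integral>x. psi (tiled n L f x) \<partial>lborel) = real n ^ CARD('n) * (\<integral>x. psi (f x) \<partial>lborel)"
proof -
  have fi: "integrable lborel f" "integrable lborel (\<lambda>x. psi (f x))" "(\<integral>x. f x \<partial>lborel) = 0"
    and f0: "\<And>x. x \<notin> cell L \<Longrightarrow> f x = 0" and fm: "\<And>x. - 1 \<le> f x"
    using f by (auto simp: perturbation_def)
  note b = fi(1)[THEN integrable_lborel_imp_borel] fi(2)[THEN integrable_lborel_imp_borel]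
  have p: "psi (tiled n L f x) = (\<Sum>j\<in>block n. psi (f (x - lat L j)))" for x
    by (rule tiled_apply[OF L(1) f0]) auto
  have ip: "integrable lborel (\<lambda>x. psi (f (x - lat L j)))" for j
    using integrable_lborel_shift[OF fi(2)] by simp
  have sp: "(\<integral>x. psi (f (x - lat L j)) \<partial>lborel) = (\<integral>x. psi (f x) \<partial>lborel)" for j
    using integral_lborel_shift[OF b(2)] by simp
  show "(\<integral>x. psi (tiled n L f x) \<partial>lborel) = real n ^ CARD('n) * (\<integral>x. psi (f x) \<partial>lborel)"
    unfolding p by (simp add: Bochner_Integration.integral_sum ip sp card_block)
  have supp: "tiled n L f x = 0" if x: "x \<notin> cell L'" for x
    unfolding tiled_def
  proof (intro sum.neutral ballI f0 notI)
    fix j :: "int^'n" assume j: "j \<in> block n" "x - lat L j \<in> cell L"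
    have "0 \<le> x $ i \<and> x $ i < L'" for i
    proof -
      have ji: "0 \<le> j $ i" "j $ i \<le> int n - 1" using j(1) by (auto simp: block_def)
      then have "real_of_int (j $ i) \<le> real n - 1" by linarith
      then have "L * real_of_int (j $ i) \<le> L * (real n - 1)" "0 \<le> L * real_of_int (j $ i)"
        using L ji by (auto intro!: mult_left_mono)
      moreover have "0 \<le> x $ i - L * real_of_int (j $ i)" "x $ i - L * real_of_int (j $ i) < L"
        using j(2) by (auto simp: cell_def)
      ultimately show ?thesis using L(2) by (auto simp: algebra_simps)
    qed
    then show False using x by (auto simp: cell_def)
  qed
  have "- 1 \<le> tiled n L f x" for x
  proof -
    \<comment> \<open>The map \<open>\<lambda>t. min 0 (t + 1)\<close> fixes 0 and vanishes exactly
      for \<open>t \<ge> - 1\<close>, so the pointwise lower bound passes through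
      \<open>tiled_apply\<close>.\<close>
    have "min 0 (tiled n L f x + 1) = (\<Sum>j\<in>block n. min 0 (f (x - lat L j) + 1))"
      by (rule tiled_apply[where F = "\<lambda>t. min 0 (t + 1)", OF L(1) f0]) auto
    also have "\<dots> = 0"
    proof (intro sum.neutral ballI)
      fix j show "min 0 (f (x - lat L j) + 1) = 0" using fm[of "x - lat L j"] by auto
    qed
    finally show ?thesis by linarith
  qed
  moreover have "integrable lborel (tiled n L f)"
    unfolding tiled_def using fi(1) by (intro Bochner_Integration.integrable_sum integrable_lborel_shift)
  moreover have "(\<integral>x. tiled n L f x \<partial>lborel) = 0"
    unfolding tiled_def
    by (subst Bochner_Integration.integral_sum)
      (auto intro!: sum.neutral integrable_lborel_shift simp: fi integral_lborel_shift[OF b(1)])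
  moreover have "integrable lborel (\<lambda>x. psi (tiled n L f x))"
    unfolding p using ip by (intro Bochner_Integration.integrable_sum)
  ultimately show "perturbation L' (tiled n L f)"
    using supp by (auto simp: perturbation_def)
qed

text \<open>Points of the cell and of its translate by \<open>p\<close> then differ by more than
  \<open>L\<close> in coordinate \<open>i\<close>, beyond the range of \<open>U\<close>.\<close>

lemma pairing_far:
  assumes U: "short_range a U" and L: "a < L" "0 \<le> a"
    and f0: "\<And>x. x \<notin> cell L \<Longrightarrow> f x = 0" and p: "2 * L \<le> \<bar>p $ i\<bar>"
  shows "pairing U f (\<lambda>x. f (x - p)) = 0"
proof -
  have z: "U (x - y) * f y * f (x - p) = 0" for x y
  proof (cases "y \<in> cell L \<and> x - p \<in> cell L")
    case True
    then have "0 \<le> y $ i" "y $ i < L" "0 \<le> x $ i - p $ i" "x $ i - p $ i < L"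
      by (auto simp: cell_def)
    then have "a < \<bar>(x - y) $ i\<bar>" using p L by simp
    also have "\<dots> \<le> norm (x - y)" by (rule component_le_norm_cart)
    finally show ?thesis using short_rangeD(2)[OF U] by simp
  qed (use f0 in auto)
  show ?thesis unfolding pairing_def by (simp only: z) simp
qed

text \<open>The deficit from \<open>n ^ CARD('n)\<close> is the boundary loss caused by
  tiling.\<close>

definition overlap :: "nat \<Rightarrow> int^'n \<Rightarrow> nat" where
  "overlap n q = card {j \<in> block n. j + q \<in> block n}"

text \<open>The form splits into interactions of pairs of cells, which depend on the offset only.
  Offsets outside \<open>neighbours\<close> are beyond the range, and \<open>overlap\<close> counts
  the other pairs. One spare cell width in \<open>L'\<close> keeps the block from interacting with
  its own periodic images.\<close>

lemma pairing_tiled: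
  fixes f :: "real^'n \<Rightarrow> real"
  assumes U: "short_range a U" and L: "a < L" "0 \<le> a" and L': "(real n + 1) * L \<le> L'"
    and f: "integrable lborel f" "\<And>x. x \<notin> cell L \<Longrightarrow> f x = 0"
  shows "pairing U (tiled n L f) (wrap L' (tiled n L f))
    = (\<Sum>q\<in>neighbours. real (overlap n q) * pairing U f (\<lambda>x. f (x - lat L q)))"
proof -
  define K where "K p = pairing U f (\<lambda>x. f (x - p))" for p
  note Ub = short_rangeD(1)[OF U]
  have Kfar: "K p = 0" if "2 * L \<le> \<bar>p $ i\<bar>" for p i
    unfolding K_def by (rule pairing_far[OF U L f(2) that])
  have L0: "0 < L" using L by linarith
  have sh: "integrable lborel (\<lambda>x. f (x - p))" for p by (rule integrable_lborel_shift[OF f(1)])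
  have "wrap L' (tiled n L f) = (\<lambda>x. \<Sum>m\<in>neighbours. \<Sum>k\<in>block n. f (x - (lat L' m + lat L k)))"
    by (auto simp: wrap_def tiled_def diff_diff_eq)
  then have "pairing U (tiled n L f) (wrap L' (tiled n L f)) = (\<Sum>j\<in>block n. \<Sum>m\<in>neighbours. \<Sum>k\<in>block n.
      pairing U (\<lambda>x. f (x - lat L j)) (\<lambda>x. f (x - (lat L' m + lat L k))))"
    unfolding tiled_def by (simp only: pairing_sum_left[OF Ub] pairing_sum_right[OF Ub] sh Bochner_Integration.integrable_sum)
  also have "\<dots> = (\<Sum>j\<in>block n. \<Sum>m\<in>neighbours. \<Sum>k\<in>block n. K (lat L' m + lat L k - lat L j))"
    unfolding K_def by (simp add: pairing_shift[OF Ub f(1) f(1)])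
  also have "\<dots> = (\<Sum>j\<in>block n. \<Sum>q\<in>neighbours. if j + q \<in> block n then K (lat L q) else 0)"
  proof (rule sum.cong[OF refl])
    fix j :: "int^'n" assume j: "j \<in> block n"
    \<comment> \<open>A nonzero wrap moves some coordinate by \<open>L'\<close>, at least
      \<open>(n + 1) * L\<close>; two cells of the block differ there by at most
      \<open>(n - 1) * L\<close>, which leaves the gap \<open>2 * L\<close> that \<open>Kfar\<close>
      asks for.\<close>
    have "(\<Sum>k\<in>block n. K (lat L' m + lat L k - lat L j)) = 0" if m: "m \<in> neighbours" "m \<noteq> 0" for m
    proof (intro sum.neutral ballI)
      fix k :: "int^'n" assume k: "k \<in> block n"
      obtain i where i: "m $ i \<noteq> 0" using m(2) by (auto simp: vec_eq_iff)
      then have mi: "m $ i = 1 \<or> m $ i = -1" using m(1) by (auto simp: neighbours_def)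
      have "\<bar>k $ i - j $ i\<bar> \<le> int n - 1"
        using k j by (auto simp: block_def abs_le_iff dest!: spec[of _ i])
      then have "\<bar>real_of_int (k $ i) - real_of_int (j $ i)\<bar> \<le> real n - 1" by linarith
      then have "L * \<bar>real_of_int (k $ i) - real_of_int (j $ i)\<bar> \<le> L * (real n - 1)"
        using L0 by (intro mult_left_mono) auto
      then have "\<bar>L * real_of_int (k $ i) - L * real_of_int (j $ i)\<bar> \<le> L * (real n - 1)"
        using L0 by (simp add: abs_mult flip: right_diff_distrib)
      then have "2 * L \<le> \<bar>(lat L' m + lat L k - lat L j) $ i\<bar>"
        using mi L' by (auto simp: algebra_simps)
      then show "K (lat L' m + lat L k - lat L j) = 0" by (rule Kfar)
    qed
    then have "(\<Sum>m\<in>neighbours. \<Sum>k\<in>block n. K (lat L' m + lat L k - lat L j))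
        = (\<Sum>m\<in>{0}. \<Sum>k\<in>block n. K (lat L' m + lat L k - lat L j))"
      using zero_neighbours by (intro sum.mono_neutral_right) auto
    also have "\<dots> = (\<Sum>k\<in>block n. K (lat L (k - j)))"
      by (auto intro!: sum.cong arg_cong[of _ _ K] simp: vec_eq_iff algebra_simps)
    \<comment> \<open>Inside the block, an offset of 2 or more in some coordinate is out of range as
      well.\<close>
    also have "\<dots> = (\<Sum>k\<in>{k\<in>block n. k - j \<in> neighbours}. K (lat L (k - j)))"
    proof (intro sum.mono_neutral_right ballI)
      fix k assume "k \<in> block n - {k\<in>block n. k - j \<in> neighbours}"
      then obtain i where "(k - j) $ i \<notin> {-1,0,1}" by (auto simp: neighbours_def)
      then have "2 \<le> \<bar>(k - j) $ i\<bar>" by auto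
      then have "2 \<le> \<bar>real_of_int ((k - j) $ i)\<bar>" by linarith
      then have "L * 2 \<le> L * \<bar>real_of_int ((k - j) $ i)\<bar>"
        using L0 by (intro mult_left_mono) auto
      then have "2 * L \<le> \<bar>lat L (k - j) $ i\<bar>" using L0 by (simp add: abs_mult)
      then show "K (lat L (k - j)) = 0" by (rule Kfar)
    qed auto
    also have "\<dots> = (\<Sum>q\<in>{q\<in>neighbours. j + q \<in> block n}. K (lat L q))"
      by (rule sum.reindex_bij_witness[where i = "\<lambda>q. j + q" and j = "\<lambda>k. k - j"]) auto
    also have "\<dots> = (\<Sum>q\<in>neighbours. if j + q \<in> block n then K (lat L q) else 0)"
      by (rule sum.inter_filter) simp
    finally show "(\<Sum>m\<in>neighbours. \<Sum>k\<in>block n. K (lat L' m + lat L k - lat L j))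
        = (\<Sum>q\<in>neighbours. if j + q \<in> block n then K (lat L q) else 0)" .
  qed
  also have "\<dots> = (\<Sum>q\<in>neighbours. \<Sum>j\<in>block n. if j + q \<in> block n then K (lat L q) else 0)"
    by (rule sum.swap)
  also have "\<dots> = (\<Sum>q\<in>neighbours. real (overlap n q) * K (lat L q))"
    by (simp add: overlap_def flip: sum.inter_filter)
  finally show ?thesis unfolding K_def .
qed

text \<open>Every cell off the boundary layer of the block still has its neighbour in direction
  \<open>q\<close> inside, so the count lies between \<open>(n - 2) ^ CARD('n)\<close> and
  \<open>n ^ CARD('n)\<close>.\<close>

lemma overlap_ratio_tendsto:
  fixes q :: "int^'n"
  assumes "q \<in> neighbours"
  shows "(\<lambda>n. real (overlap n q) / real n ^ CARD('n)) \<longlonglongrightarrow> 1"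
proof (rule tendsto_sandwich)
  have "(\<lambda>n. 1 - 2 / real n) \<longlonglongrightarrow> 1 - 0"
    by (intro tendsto_intros lim_const_over_n)
  from tendsto_power[OF this, of "CARD('n)"]
  show "(\<lambda>n. (1 - 2 / real n) ^ CARD('n)) \<longlonglongrightarrow> 1" by simp
  show "\<forall>\<^sub>F n in sequentially. (1 - 2 / real n) ^ CARD('n) \<le> real (overlap n q) / real n ^ CARD('n)"
    using eventually_ge_at_top[of 2]
  proof eventually_elim
    case (elim n)
    have "{j::int^'n. \<forall>i. j $ i \<in> {1..<int n - 1}} \<subseteq> {j \<in> block n. j + q \<in> block n}"
    proof (clarsimp simp: block_def, intro conjI allI)
      fix j :: "int^'n" and i
      assume j: "\<forall>i. 1 \<le> j $ i \<and> j $ i < int n - 1"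
      have "q $ i \<in> {-1,0,1}" using assms by (auto simp: neighbours_def)
      then show "0 \<le> j $ i" "j $ i < int n" "0 \<le> j $ i + q $ i" "j $ i + q $ i < int n"
        using j[rule_format, of i] by auto
    qed
    then have "card {j::int^'n. \<forall>i. j $ i \<in> {1..<int n - 1}} \<le> overlap n q"
      unfolding overlap_def by (intro card_mono) auto
    moreover have "card {1..<int n - 1} = n - 2"
      using elim by simp
    ultimately have "(n - 2) ^ CARD('n) \<le> overlap n q"
      by (simp only: finite_card_vec_box(2)[OF finite_atLeastLessThan_int])
    then have "real ((n - 2) ^ CARD('n)) \<le> real (overlap n q)" by (simp only: of_nat_le_iff)
    moreover have "1 - 2 / real n = real (n - 2) / real n" using elim by (simp add: of_nat_diff field_simps)
    ultimately show ?case by (simp add: power_divide divide_right_mono)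
  qed
  show "\<forall>\<^sub>F n in sequentially. real (overlap n q) / real n ^ CARD('n) \<le> 1"
  proof (intro always_eventually allI)
    fix n
    have "overlap n q \<le> card (block n :: (int^'n) set)"
      unfolding overlap_def by (intro card_mono) auto
    then have "real (overlap n q) \<le> real n ^ CARD('n)"
      by (simp add: card_block flip: of_nat_power)
    then show "real (overlap n q) / real n ^ CARD('n) \<le> 1"
      by (cases "n = 0") (auto simp: divide_le_eq_1 zero_power)
  qed
qed simp

text \<open>Divided by the number of cells, the excess of the tiled function tends to that of
  \<open>f\<close> on its own torus as \<open>n\<close> grows, hence is negative for some fixed
  \<open>n\<close>. The tiled function and its excess are then the same on every torus with room for
  the block.\<close>

lemma negative_energy_transfer:
  fixes f :: "real^'n \<Rightarrow> real"
  assumes U: "short_range a U" and L: "a < L" "0 \<le> a" and f: "perturbation L f"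
    and neg: "(\<integral>x. psi (f x) \<partial>lborel) + \<theta> / 2 * pairing U f (wrap L f) < 0"
  shows "\<exists>M. \<forall>L'\<ge>M. \<exists>f'. perturbation L' f' \<and>
    (\<integral>x. psi (f' x) \<partial>lborel) + \<theta> / 2 * pairing U f' (wrap L' f') < 0"
proof -
  define K where "K q = pairing U f (\<lambda>x. f (x - lat L q))" for q
  have L0: "0 < L" using L by linarith
  have fi: "integrable lborel f" and f0: "\<And>x. x \<notin> cell L \<Longrightarrow> f x = 0"
    using f by (auto simp: perturbation_def)
  have "pairing U f (wrap L f) = (\<Sum>q\<in>neighbours. K q)"
    unfolding wrap_def K_def using fi by (intro pairing_sum_right short_rangeD(1)[OF U] integrable_lborel_shift)
  moreover have "(\<lambda>n. (\<integral>x. psi (f x) \<partial>lborel) + \<theta> / 2 * (\<Sum>q\<in>neighbours. real (overlap n q) / real n ^ CARD('n) * K q))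
      \<longlonglongrightarrow> (\<integral>x. psi (f x) \<partial>lborel) + \<theta> / 2 * (\<Sum>q\<in>neighbours. 1 * K q)"
    by (intro tendsto_intros overlap_ratio_tendsto)
  ultimately have "\<forall>\<^sub>F n in sequentially.
      (\<integral>x. psi (f x) \<partial>lborel) + \<theta> / 2 * (\<Sum>q\<in>neighbours. real (overlap n q) / real n ^ CARD('n) * K q) < 0"
    using neg by (intro order_tendstoD(2)) auto
  then obtain N where N: "\<And>n. N \<le> n \<Longrightarrow> 
    (\<integral>x. psi (f x) \<partial>lborel) + \<theta> / 2 * (\<Sum>q\<in>neighbours. real (overlap n q) / real n ^ CARD('n) * K q) < 0"
    by (auto simp: eventually_sequentially)
  \<comment> \<open>The successor ensures \<open>n > 0\<close>, which the division by
    \<open>n ^ CARD('n)\<close> requires.\<close>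
  define n where "n = Suc N"
  have n: "0 < n"
    "(\<integral>x. psi (f x) \<partial>lborel) + \<theta> / 2 * (\<Sum>q\<in>neighbours. real (overlap n q) / real n ^ CARD('n) * K q) < 0"
    using N[of n] by (auto simp: n_def)
  have "\<exists>f'. perturbation L' f' \<and> (\<integral>x. psi (f' x) \<partial>lborel) + \<theta> / 2 * pairing U f' (wrap L' f') < 0"
    if L': "(real n + 1) * L \<le> L'" for L'
  proof (intro exI conjI)
    have nL: "real n * L \<le> L'" using L' L0 by (simp add: algebra_simps)
    show "perturbation L' (tiled n L f)" by (rule perturbation_tiled(1)[OF L0 nL f])
    have pt: "pairing U (tiled n L f) (wrap L' (tiled n L f)) = (\<Sum>q\<in>neighbours. real (overlap n q) * K q)"
      unfolding K_def by (rule pairing_tiled[OF U L L' fi f0])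
    have "(\<Sum>q\<in>neighbours. real (overlap n q) * K q)
        = real n ^ CARD('n) * (\<Sum>q\<in>neighbours. real (overlap n q) / real n ^ CARD('n) * K q)"
      using n(1) by (simp add: sum_distrib_left)
    then have "(\<integral>x. psi (tiled n L f x) \<partial>lborel) + \<theta> / 2 * pairing U (tiled n L f) (wrap L' (tiled n L f))
        = real n ^ CARD('n) * ((\<integral>x. psi (f x) \<partial>lborel)
            + \<theta> / 2 * (\<Sum>q\<in>neighbours. real (overlap n q) / real n ^ CARD('n) * K q))"
      using pt by (simp only: perturbation_tiled(2)[OF L0 nL f] distrib_left mult.left_commute)
    also have "\<dots> < 0" using n by (intro mult_pos_neg) auto
    finally show "(\<integral>x. psi (tiled n L f x) \<partial>lborel)
        + \<theta> / 2 * pairing U (tiled n L f) (wrap L' (tiled n L f)) < 0" .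
  qed
  then show ?thesis by blast
qed

section \<open>Free energy of a perturbed uniform density\<close>

lemma borel_measurable_completion_AE_eq:
  fixes F G :: "'a \<Rightarrow> 'b::topological_space"
  assumes G: "G \<in> borel_measurable (completion M)" and ae: "AE x in completion M. F x = G x"
  shows "F \<in> borel_measurable (completion M)"
proof (rule measurableI)
  fix A :: "'b set" assume A: "A \<in> sets borel"
  show "F -` A \<inter> space (completion M) \<in> sets (completion M)"
  proof (rule completion.in_sets_AE)
    show "AE x in completion M. x \<in> G -` A \<inter> space (completion M) \<longleftrightarrow> x \<in> F -` A \<inter> space (completion M)"
      using ae by eventually_elim auto
    show "G -` A \<inter> space (completion M) \<in> sets (completion M)"
      using G A by (rule measurable_sets)
  qed auto
qed auto

text \<open>Bridge from the integrals in the definitions to those used here. Completeness of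
  Lebesgue measure supplies the measurability of \<open>F\<close>, which agrees with a Borel
  function almost everywhere on the box.\<close>

lemma torus_integral:
  fixes F G :: "real^'n \<Rightarrow> 'b::{banach,second_countable_topology}"
  assumes [measurable]: "G \<in> borel_measurable borel" and G0: "\<And>x. x \<notin> cell L \<Longrightarrow> G x = 0"
    and ae: "AE x in lborel. x \<in> torus_box L \<longrightarrow> F x = G x"
  shows "integrable (lebesgue_on (torus_box L)) F \<longleftrightarrow> integrable lborel G"
    and "integral\<^sup>L (lebesgue_on (torus_box L)) F = integral\<^sup>L lborel G"
proof -
  have S: "torus_box L \<inter> space lebesgue \<in> sets (lebesgue :: (real^'n) measure)"
    by (simp add: torus_box_def)
  have ae': "AE x in lebesgue. indicator (torus_box L) x *\<^sub>R F x = G x"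
    using ae[THEN AE_completion]
  proof eventually_elim
    case (elim x)
    then show ?case using G0[of x] torus_box_cell[of L] by (cases "x \<in> torus_box L") auto
  qed
  have G: "G \<in> borel_measurable lebesgue" by (auto intro: measurable_completion)
  have F: "(\<lambda>x. indicator (torus_box L) x *\<^sub>R F x) \<in> borel_measurable lebesgue"
    by (rule borel_measurable_completion_AE_eq[OF G ae'])
  have "integrable (lebesgue_on (torus_box L)) F \<longleftrightarrow> integrable lebesgue (\<lambda>x. indicator (torus_box L) x *\<^sub>R F x)"
    by (rule integrable_restrict_space[OF S])
  also have "\<dots> \<longleftrightarrow> integrable lebesgue G" by (rule integrable_cong_AE[OF F G ae'])
  also have "\<dots> \<longleftrightarrow> integrable lborel G" by (rule integrable_completion) simp
  finally show "integrable (lebesgue_on (torus_box L)) F \<longleftrightarrow> integrable lborel G" .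
  have "integral\<^sup>L (lebesgue_on (torus_box L)) F = integral\<^sup>L lebesgue (\<lambda>x. indicator (torus_box L) x *\<^sub>R F x)"
    by (rule integral_restrict_space[OF S])
  also have "\<dots> = integral\<^sup>L lebesgue G" by (rule integral_cong_AE[OF F G ae'])
  also have "\<dots> = integral\<^sup>L lborel G" by (rule integral_completion) simp
  finally show "integral\<^sup>L (lebesgue_on (torus_box L)) F = integral\<^sup>L lborel G" .
qed

text \<open>The bound on \<open>x\<close> holds for differences of points of the torus box. An image
  with \<open>\<bar>m $ i\<bar> \<ge> 2\<close> then lies at distance at least \<open>L > a\<close>
  from the origin, so only finitely many terms survive.\<close>

lemma periodize_finite:
  fixes x :: "real^'n"
  assumes V: "\<And>z. a < norm z \<Longrightarrow> V z = 0" and L: "a < L" "0 \<le> a" and x: "\<And>i. \<bar>x $ i\<bar> \<le> L"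
  shows "periodize L V x = (\<Sum>m\<in>neighbours. V (x + lat L m))"
proof -
  have "V (x + lat L m) = 0" if m: "m \<notin> neighbours" for m :: "int^'n"
  proof (rule V)
    obtain i where "m $ i \<notin> {-1,0,1}" using m by (auto simp: neighbours_def)
    then have "2 \<le> \<bar>m $ i\<bar>" by auto
    then have "2 \<le> \<bar>real_of_int (m $ i)\<bar>" by linarith
    then have "L * 2 \<le> L * \<bar>real_of_int (m $ i)\<bar>" using L by (intro mult_left_mono) auto
    then have "2 * L \<le> \<bar>L * real_of_int (m $ i)\<bar>" using L by (simp add: abs_mult)
    then have "a < \<bar>(x + lat L m) $ i\<bar>" using x[of i] L by simp
    also have "\<dots> \<le> norm (x + lat L m)" by (rule component_le_norm_cart)
    finally show "a < norm (x + lat L m)" .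
  qed
  then have "periodize L V x = infsum (\<lambda>m. V (x + lat L m)) neighbours"
    unfolding periodize_def lat_def[symmetric] by (intro infsum_cong_neutral) auto
  then show ?thesis by simp
qed

text \<open>\<open>V\<close> enters the definitions pointwise and need only be Lebesgue measurable;
  \<open>U\<close> is a Borel version of it, to which product measures and Fubini apply.\<close>

locale potential =
  fixes V U :: "real^'n \<Rightarrow> real" and a L :: real
  assumes V0: "\<And>z. a < norm z \<Longrightarrow> V z = 0" and U: "short_range a U"
    and VU: "AE z in lborel. V z = U z" and L: "a < L" "0 \<le> a"
begin

lemma U_borel [measurable]: "U \<in> borel_measurable borel"
  by (rule bounded_borel_measurable[OF short_rangeD(1)[OF U]])

lemma L_pos: "0 < L" using L by linarith

text \<open>Periodizing the kernel amounts to wrapping the function: each lattice translation is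
  moved from the kernel to \<open>r\<close> by a change of variables in the inner integral.\<close>

lemma interaction_eq:
  assumes r: "integrable lborel r" "\<And>x. x \<notin> cell L \<Longrightarrow> r x = 0"
    and ae: "AE x in lborel. x \<in> torus_box L \<longrightarrow> \<rho> x = r x"
  shows "interaction L V \<rho> = pairing U r (wrap L r)"
proof -
  note [measurable] = integrable_lborel_imp_borel[OF r(1)]
  obtain C where C: "\<And>z. \<bar>U z\<bar> \<le> C" using short_rangeD(1)[OF U] by (auto simp: bounded_borel_def)
  have iU: "integrable lborel (\<lambda>y. U (z - y) * r y)" if "integrable lborel r" for z r
  proof (rule Bochner_Integration.integrable_bound)
    note [measurable] = integrable_lborel_imp_borel[OF that]
    show "integrable lborel (\<lambda>y. C * r y)" using that by simp
    have "norm (U (z - y) * r y) \<le> norm (C * r y)" for y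
      using mult_right_mono[OF order_trans[OF C[of "z - y"] abs_ge_self[of C]], of "\<bar>r y\<bar>"]
      by (simp add: abs_mult)
    then show "AE y in lborel. norm (U (z - y) * r y) \<le> norm (C * r y)" by simp
    show "(\<lambda>y. U (z - y) * r y) \<in> borel_measurable lborel" by measurable
  qed
  have inner: "integral\<^sup>L (lebesgue_on (torus_box L)) (\<lambda>y. periodize L V (x - y) * \<rho> y)
      = (\<integral>y. U (x - y) * wrap L r y \<partial>lborel)" if x: "x \<in> torus_box L" for x
  proof -
    \<comment> \<open>For fixed \<open>x\<close> the exceptional null set of \<open>V = U\<close> is
      reflected and translated; a finite union of such sets is still null.\<close>
    have "AE y in lborel. \<forall>m\<in>neighbours. V (x + lat L m - y) = U (x + lat L m - y)"
      by (intro AE_finite_allI finite_neighbours AE_lborel_reflect VU)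
    with ae have "AE y in lborel. y \<in> torus_box L \<longrightarrow>
        periodize L V (x - y) * \<rho> y = (\<Sum>m\<in>neighbours. U (x + lat L m - y) * r y)"
    proof eventually_elim
      case (elim y)
      show ?case
      proof
        assume y: "y \<in> torus_box L"
        have "\<bar>(x - y) $ i\<bar> \<le> L" for i
        proof -
          have "0 \<le> x $ i" "x $ i \<le> L" "0 \<le> y $ i" "y $ i \<le> L"
            using x y by (auto simp: torus_box_def mem_box_cart)
          then show ?thesis by simp
        qed
        from periodize_finite[where V = V, OF V0 L this]
        have "periodize L V (x - y) = (\<Sum>m\<in>neighbours. U (x + lat L m - y))"
          using elim by (simp add: algebra_simps)
        then show "periodize L V (x - y) * \<rho> y = (\<Sum>m\<in>neighbours. U (x + lat L m - y) * r y)"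
          using elim y by (simp add: sum_distrib_right)
      qed
    qed
    then have "integral\<^sup>L (lebesgue_on (torus_box L)) (\<lambda>y. periodize L V (x - y) * \<rho> y)
        = (\<integral>y. (\<Sum>m\<in>neighbours. U (x + lat L m - y) * r y) \<partial>lborel)"
      by (intro torus_integral(2)) (auto simp: r)
    also have "\<dots> = (\<Sum>m\<in>neighbours. (\<integral>y. U (x + lat L m - y) * r y \<partial>lborel))"
      using iU[OF r(1)] by (intro Bochner_Integration.integral_sum)
    also have "\<dots> = (\<Sum>m\<in>neighbours. (\<integral>y. U (x - lat L m - y) * r y \<partial>lborel))"
      by (subst sum.reindex_bij_betw[OF uminus_neighbours, symmetric]) (simp add: lat_uminus)
    also have "\<dots> = (\<Sum>m\<in>neighbours. (\<integral>y. U (x - y) * r (y - lat L m) \<partial>lborel))"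
    proof (rule sum.cong[OF refl])
      fix m :: "int^'n"
      have "(\<integral>y. U (x - lat L m - y) * r y \<partial>lborel)
          = (\<integral>y. U (x - lat L m - (y - lat L m)) * r (y - lat L m) \<partial>lborel)"
        by (rule integral_lborel_shift[symmetric]) measurable
      then show "(\<integral>y. U (x - lat L m - y) * r y \<partial>lborel) = (\<integral>y. U (x - y) * r (y - lat L m) \<partial>lborel)"
        by simp
    qed
    also have "\<dots> = (\<integral>y. (\<Sum>m\<in>neighbours. U (x - y) * r (y - lat L m)) \<partial>lborel)"
      using iU[OF integrable_lborel_shift[OF r(1)]] by (intro Bochner_Integration.integral_sum[symmetric])
    finally show ?thesis by (simp add: wrap_def sum_distrib_left)
  qed
  have "interaction L V \<rho> = (\<integral>x. (\<integral>y. U (x - y) * wrap L r y \<partial>lborel) * r x \<partial>lborel)"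
    unfolding interaction_def
  proof (rule torus_integral(2))
    note [measurable] = integrable_lborel_imp_borel[OF integrable_wrap[OF r(1)]]
    show "(\<lambda>x. (\<integral>y. U (x - y) * wrap L r y \<partial>lborel) * r x) \<in> borel_measurable borel"
      by measurable
    show "AE x in lborel. x \<in> torus_box L \<longrightarrow>
        integral\<^sup>L (lebesgue_on (torus_box L)) (\<lambda>y. periodize L V (x - y) * \<rho> y) * \<rho> x
        = (\<integral>y. U (x - y) * wrap L r y \<partial>lborel) * r x"
      using ae by eventually_elim (auto simp: inner)
  qed (simp add: r)
  also have "\<dots> = pairing U (wrap L r) r"
    using r(1) by (intro pairing_Fubini(1)[symmetric] short_rangeD(1)[OF U] integrable_wrap)
  also have "\<dots> = pairing U r (wrap L r)"
    using r(1) by (intro pairing_wrap_swap[symmetric] short_rangeD(1)[OF U])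
  finally show ?thesis .
qed

text \<open>Equality holds almost everywhere because \<open>f\<close> is Borel while a density is
  only Lebesgue measurable; support and lower bound hold everywhere, so that they can be used
  pointwise.\<close>

definition represents :: "(real^'n \<Rightarrow> real) \<Rightarrow> (real^'n \<Rightarrow> real) \<Rightarrow> bool" where
  "represents f \<rho> \<longleftrightarrow> f \<in> borel_measurable borel \<and> (\<forall>x. x \<notin> cell L \<longrightarrow> f x = 0) \<and> (\<forall>x. - 1 \<le> f x)
    \<and> (AE x in lborel. x \<in> torus_box L \<longrightarrow> \<rho> x = (1 + f x) / L ^ CARD('n))"

lemma integral_indicator_cell: "(\<integral>x. indicator (cell L :: (real^'n) set) x \<partial>lborel) = L ^ CARD('n)"
  using measure_cell[of L] L_pos by simp

lemma integral_density:
  assumes "represents f \<rho>"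
  shows "integrable (lebesgue_on (torus_box L)) \<rho> \<longleftrightarrow> integrable lborel f"
    and "integrable lborel f \<Longrightarrow>
      integral\<^sup>L (lebesgue_on (torus_box L)) \<rho> = 1 + (\<integral>x. f x \<partial>lborel) / L ^ CARD('n)"
proof -
  have [measurable]: "f \<in> borel_measurable borel" and f0: "\<And>x. x \<notin> cell L \<Longrightarrow> f x = 0"
    and ae: "AE x in lborel. x \<in> torus_box L \<longrightarrow> \<rho> x = (1 + f x) / L ^ CARD('n)"
    using assms by (auto simp: represents_def)
  let ?r = "\<lambda>x. (indicator (cell L) x + f x) / L ^ CARD('n)"
  have ae': "AE x in lborel. x \<in> torus_box L \<longrightarrow> \<rho> x = ?r x"
    using ae AE_torus_box_cell[of L] by eventually_elim auto
  have "integrable lborel ?r \<longleftrightarrow> integrable lborel f"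
  proof
    assume "integrable lborel ?r"
    then have "integrable lborel (\<lambda>x. L ^ CARD('n) * ?r x - indicator (cell L) x)"
      by (intro Bochner_Integration.integrable_diff integrable_mult_right) auto
    then show "integrable lborel f" using L_pos by simp
  qed auto
  then show "integrable (lebesgue_on (torus_box L)) \<rho> \<longleftrightarrow> integrable lborel f"
    using torus_integral(1)[OF _ _ ae'] f0 by simp
  assume "integrable lborel f"
  then have "integral\<^sup>L lborel ?r = (L ^ CARD('n) + (\<integral>x. f x \<partial>lborel)) / L ^ CARD('n)"
    by (simp add: integral_indicator_cell[simplified])
  then show "integral\<^sup>L (lebesgue_on (torus_box L)) \<rho> = 1 + (\<integral>x. f x \<partial>lborel) / L ^ CARD('n)"
    using torus_integral(2)[OF _ _ ae'] f0 L_pos by (simp add: field_simps)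
qed

text \<open>On the cell, \<open>L ^ CARD('n) * \<rho> * ln \<rho>\<close> is
  \<open>(1 + f) * (ln (1 + f) - ln (L ^ CARD('n)))\<close>, and
  \<open>(1 + f) * ln (1 + f) = psi f + f\<close>. The terms linear in \<open>f\<close> integrate to
  0, so \<open>psi\<close> and a constant survive.\<close>

lemma density_entropy:
  assumes rep: "represents f \<rho>" and \<rho>: "\<rho> \<in> densities L"
  shows "integrable (lebesgue_on (torus_box L)) (\<lambda>x. \<rho> x * ln (\<rho> x)) \<longleftrightarrow> integrable lborel (\<lambda>x. psi (f x))"
    and "integrable lborel (\<lambda>x. psi (f x)) \<Longrightarrow> integral\<^sup>L (lebesgue_on (torus_box L)) (\<lambda>x. \<rho> x * ln (\<rho> x))
        = (\<integral>x. psi (f x) \<partial>lborel) / L ^ CARD('n) - ln (L ^ CARD('n))"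
    and "integrable lborel (\<lambda>x. psi (f x)) \<Longrightarrow> perturbation L f"
proof -
  have [measurable]: "f \<in> borel_measurable borel" and f0: "\<And>x. x \<notin> cell L \<Longrightarrow> f x = 0"
    and fm: "\<And>x. - 1 \<le> f x"
    and ae: "AE x in lborel. x \<in> torus_box L \<longrightarrow> \<rho> x = (1 + f x) / L ^ CARD('n)"
    using rep by (auto simp: represents_def)
  have fi: "integrable lborel f" using \<rho> integral_density(1)[OF rep] by (simp add: densities_def)
  have fz: "(\<integral>x. f x \<partial>lborel) = 0"
    using \<rho> integral_density(2)[OF rep fi] L_pos by (simp add: densities_def)
  show "perturbation L f" if "integrable lborel (\<lambda>x. psi (f x))"
    using that fi fz f0 fm by (simp add: perturbation_def)
  let ?e = "\<lambda>x. (psi (f x) + f x - f x * ln (L ^ CARD('n)) - indicator (cell L) x * ln (L ^ CARD('n))) / L ^ CARD('n)"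
  have "AE x in lborel. x \<in> torus_box L \<longrightarrow> \<rho> x * ln (\<rho> x) = ?e x"
    using ae AE_torus_box_cell[of L]
  proof eventually_elim
    case (elim x)
    show ?case
    proof
      assume x: "x \<in> torus_box L"
      \<comment> \<open>At \<open>f x = - 1\<close> the density vanishes and both sides are 0;
        elsewhere the logarithm of the quotient splits.\<close>
      show "\<rho> x * ln (\<rho> x) = ?e x"
      proof (cases "f x = - 1")
        case False
        then have "0 < 1 + f x" using fm[of x] by auto
        then have "ln (\<rho> x) = ln (1 + f x) - ln (L ^ CARD('n))"
          using elim x L_pos by (simp add: ln_div)
        moreover have "\<rho> x = (1 + f x) / L ^ CARD('n)" using elim x by simp
        ultimately have "\<rho> x * ln (\<rho> x) = (1 + f x) * (ln (1 + f x) - ln (L ^ CARD('n))) / L ^ CARD('n)"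
          by simp
        moreover have "(1 + f x) * (ln (1 + f x) - ln (L ^ CARD('n)))
            = psi (f x) + f x - f x * ln (L ^ CARD('n)) - ln (L ^ CARD('n))"
          by (simp add: psi_def algebra_simps)
        ultimately show ?thesis using elim x by simp
      qed (use elim x in \<open>simp add: psi_def\<close>)
    qed
  qed
  note t = torus_integral[OF _ _ this]
  have "integrable lborel ?e \<longleftrightarrow> integrable lborel (\<lambda>x. psi (f x))"
  proof
    assume "integrable lborel ?e"
    then have "integrable lborel (\<lambda>x. L ^ CARD('n) * ?e x - f x + f x * ln (L ^ CARD('n)) + indicator (cell L) x * ln (L ^ CARD('n)))"
      by (intro Bochner_Integration.integrable_add Bochner_Integration.integrable_diff
          integrable_mult_right integrable_mult_left fi) auto
    then show "integrable lborel (\<lambda>x. psi (f x))" using L_pos by simp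
  qed (use fi in auto)
  then show "integrable (lebesgue_on (torus_box L)) (\<lambda>x. \<rho> x * ln (\<rho> x)) \<longleftrightarrow> integrable lborel (\<lambda>x. psi (f x))"
    using t(1) f0 by simp
  assume "integrable lborel (\<lambda>x. psi (f x))"
  then have "integral\<^sup>L lborel ?e = ((\<integral>x. psi (f x) \<partial>lborel) - L ^ CARD('n) * ln (L ^ CARD('n))) / L ^ CARD('n)"
    using fi by (simp add: fz integral_indicator_cell[simplified])
  then show "integral\<^sup>L (lebesgue_on (torus_box L)) (\<lambda>x. \<rho> x * ln (\<rho> x))
        = (\<integral>x. psi (f x) \<partial>lborel) / L ^ CARD('n) - ln (L ^ CARD('n))"
    using t(2) f0 L_pos by (simp add: diff_divide_distrib)
qed

text \<open>In the expansion around the uniform density both cross terms are the integral of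
  \<open>U\<close> times that of \<open>f\<close>, hence 0.\<close>

lemma interaction_perturbation:
  assumes rep: "represents f \<rho>" and f: "perturbation L f"
  shows "interaction L V \<rho> = ((\<integral>z. U z \<partial>lborel) * L ^ CARD('n) + pairing U f (wrap L f)) / (L ^ CARD('n))\<^sup>2"
proof -
  have fi: "integrable lborel f" "(\<integral>x. f x \<partial>lborel) = 0" and f0: "\<And>x. x \<notin> cell L \<Longrightarrow> f x = 0"
    and ae: "AE x in lborel. x \<in> torus_box L \<longrightarrow> \<rho> x = (1 + f x) / L ^ CARD('n)"
    using rep f by (auto simp: represents_def perturbation_def)
  let ?c = "indicator (cell L) :: real^'n \<Rightarrow> real"
  let ?h = "\<lambda>x. ?c x + f x"
  have c0: "x \<notin> cell L \<Longrightarrow> ?c x = 0" for x by simp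
  have ae': "AE x in lborel. x \<in> torus_box L \<longrightarrow> \<rho> x = 1 / L ^ CARD('n) * ?h x"
    using ae AE_torus_box_cell[of L] by eventually_elim auto
  have "interaction L V \<rho> = pairing U (\<lambda>x. 1 / L ^ CARD('n) * ?h x) (wrap L (\<lambda>x. 1 / L ^ CARD('n) * ?h x))"
    using f0 fi(1) by (intro interaction_eq ae' integrable_mult_right) auto
  also have "\<dots> = pairing U ?h (wrap L ?h) / (L ^ CARD('n))\<^sup>2"
    by (simp only: wrap_scale pairing_scale_left pairing_scale_right) (simp add: power2_eq_square)
  also have "pairing U ?h (wrap L ?h) = pairing U ?c (wrap L ?c) + pairing U ?c (wrap L f)
      + pairing U f (wrap L ?c) + pairing U f (wrap L f)"
    unfolding wrap_add by (simp add: pairing_add_left pairing_add_right short_rangeD(1)[OF U] fi integrable_wrap)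
  also have "\<dots> = (\<integral>z. U z \<partial>lborel) * L ^ CARD('n) + pairing U f (wrap L f)"
    using pairing_wrap_cell_right[OF U L _ c0] pairing_wrap_cell_right[OF U L fi(1) f0]
      pairing_wrap_cell_left[OF U L fi(1) f0]
    by (simp add: fi integral_indicator_cell[simplified])
  finally show ?thesis .
qed

definition excess :: "real \<Rightarrow> (real^'n \<Rightarrow> real) \<Rightarrow> real" where
  "excess \<theta> f = (\<integral>x. psi (f x) \<partial>lborel) + \<theta> / 2 * pairing U f (wrap L f)"

text \<open>Only \<open>excess\<close> depends on \<open>f\<close>, so comparison with
  \<open>rho0\<close> reduces to the sign of the excess.\<close>

lemma free_energy_perturbation:
  assumes rep: "represents f \<rho>" and \<rho>: "\<rho> \<in> densities L" and f: "perturbation L f"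
  shows "free_energy L V \<theta> \<rho>
    = ereal (- ln (L ^ CARD('n)) + \<theta> / 2 * (\<integral>z. U z \<partial>lborel) + excess \<theta> f / L ^ CARD('n))"
proof -
  have p: "integrable lborel (\<lambda>x. psi (f x))" using f by (simp add: perturbation_def)
  have alg: "E / N - l + 1 / 2 * \<theta> * N * ((u * N + w) / N\<^sup>2) = - l + \<theta> / 2 * u + (E + \<theta> / 2 * w) / N"
    if "0 < N" for E N l u w :: real
    using that by (simp add: field_simps power2_eq_square)
  have "L ^ CARD('n) > 0" using L_pos by simp
  from alg[OF this] show ?thesis
    unfolding free_energy_def interaction_perturbation[OF rep f] density_entropy(2)[OF rep \<rho> p]
    using density_entropy(1)[OF rep \<rho>] p by (simp only: excess_def if_True)
qed

lemma density_represented: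
  assumes "\<rho> \<in> densities L"
  shows "\<exists>f. represents f \<rho>"
proof -
  have "\<rho> \<in> borel_measurable (lebesgue_on (torus_box L))" and pos: "\<And>x. x \<in> torus_box L \<Longrightarrow> 0 \<le> \<rho> x"
    using assms by (auto simp: densities_def)
  then have "(\<lambda>x. if x \<in> torus_box L then \<rho> x else 0) \<in> borel_measurable lebesgue"
    by (intro borel_measurable_if_I) (auto simp: torus_box_def)
  then obtain r where [measurable]: "r \<in> borel_measurable lborel"
    and r: "AE x in lborel. (if x \<in> torus_box L then \<rho> x else 0) = r x"
    using completion_ex_borel_measurable_real by blast
  \<comment> \<open>The Borel version \<open>r\<close> may be negative on a null set;
    \<open>max 0\<close> restores \<open>f \<ge> - 1\<close> at every point.\<close>
  define f where "f x = (if x \<in> cell L then L ^ CARD('n) * max 0 (r x) - 1 else 0)" for x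
  have [measurable]: "r \<in> borel_measurable borel" using \<open>r \<in> borel_measurable lborel\<close> by simp
  have v: "L ^ CARD('n) > 0" using L_pos by simp
  have "AE x in lborel. x \<in> torus_box L \<longrightarrow> \<rho> x = (1 + f x) / L ^ CARD('n)"
    using r AE_torus_box_cell[of L]
  proof eventually_elim
    case (elim x)
    then show ?case using pos[of x] L_pos by (auto simp: f_def max_def)
  qed
  moreover have "f \<in> borel_measurable borel" unfolding f_def by measurable
  moreover have "- 1 \<le> f x" for x using v by (auto simp: f_def)
  ultimately show ?thesis by (auto simp: represents_def f_def)
qed

lemma perturbation_density:
  assumes "perturbation L f"
  defines "\<rho> \<equiv> \<lambda>x. (1 + f x) / L ^ CARD('n)"
  shows "\<rho> \<in> densities L" "represents f \<rho>"
proof -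
  have fi: "integrable lborel f" "(\<integral>x. f x \<partial>lborel) = 0" and f0: "\<And>x. x \<notin> cell L \<Longrightarrow> f x = 0"
    and fm: "\<And>x. - 1 \<le> f x"
    using assms by (auto simp: perturbation_def)
  note [measurable] = integrable_lborel_imp_borel[OF fi(1)]
  show rep: "represents f \<rho>" using f0 fm by (simp add: represents_def \<rho>_def)
  have "0 \<le> \<rho> x" for x using fm[of x] L_pos by (simp add: \<rho>_def)
  moreover have i: "integrable (lebesgue_on (torus_box L)) \<rho>" using integral_density(1)[OF rep] fi by simp
  ultimately show "\<rho> \<in> densities L"
    using integral_density(2)[OF rep fi(1)] fi by (auto simp: densities_def)
qed

section \<open>Comparison with the uniform density\<close>

lemma perturbation_0: "perturbation L (\<lambda>x. 0)"
  by (simp add: perturbation_def)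

lemma excess_0 [simp]: "excess \<theta> (\<lambda>x. 0) = 0"
  by (simp add: excess_def pairing_def)

lemma free_energy_rho0:
  "free_energy L V \<theta> (rho0 L) = ereal (- ln (L ^ CARD('n)) + \<theta> / 2 * (\<integral>z. U z \<partial>lborel))"
  using free_energy_perturbation[OF perturbation_density(2)[OF perturbation_0] perturbation_density(1)[OF perturbation_0]]
    perturbation_0 by (simp add: rho0_def)

lemma rho0_density: "(rho0 L :: real^'n \<Rightarrow> real) \<in> densities L"
  using perturbation_density(1)[OF perturbation_0] by (simp add: rho0_def)

lemma free_energy_le_rho0_iff:
  assumes "perturbation L f" "\<rho> \<in> densities L" "represents f \<rho>"
  shows "free_energy L V \<theta> \<rho> \<le> free_energy L V \<theta> (rho0 L) \<longleftrightarrow> excess \<theta> f \<le> 0"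
    and "free_energy L V \<theta> \<rho> < free_energy L V \<theta> (rho0 L) \<longleftrightarrow> excess \<theta> f < 0"
proof -
  have v: "0 < L ^ CARD('n)" using L_pos by simp
  show "free_energy L V \<theta> \<rho> \<le> free_energy L V \<theta> (rho0 L) \<longleftrightarrow> excess \<theta> f \<le> 0"
    unfolding free_energy_rho0 free_energy_perturbation[OF assms(3,2,1)]
    using pos_divide_le_eq[OF v, of "excess \<theta> f" 0]
    by (simp only: ereal_less_eq(3) add_le_same_cancel1 mult_zero_left)
  show "free_energy L V \<theta> \<rho> < free_energy L V \<theta> (rho0 L) \<longleftrightarrow> excess \<theta> f < 0"
    unfolding free_energy_rho0 free_energy_perturbation[OF assms(3,2,1)]
    using pos_divide_less_eq[OF v, of "excess \<theta> f" 0]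
    by (simp only: less_ereal.simps(1) add_less_same_cancel1 mult_zero_left)
qed

lemma not_unique_if_negative_excess:
  assumes "perturbation L f" "excess \<theta> f < 0"
  shows "\<not> unique_min_rho0 L V \<theta>"
  using perturbation_density[OF assms(1)] free_energy_le_rho0_iff(2)[OF assms(1)] assms(2)
  by (force simp: unique_min_rho0_def is_minimizer_def not_less[symmetric])

lemma entropy_pos:
  assumes f: "perturbation L f" and ne: "\<not> (AE x in lborel. f x = 0)"
  shows "0 < (\<integral>x. psi (f x) \<partial>lborel)"
proof -
  have i: "integrable lborel (\<lambda>x. psi (f x))" and fm: "\<And>x. - 1 \<le> f x"
    using f by (auto simp: perturbation_def)
  have "(\<integral>x. psi (f x) \<partial>lborel) \<noteq> 0"
    using ne psi_nonneg[OF fm] psi_eq_0_iff[OF fm] by (subst integral_nonneg_eq_0_iff_AE[OF i]) auto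
  moreover have "0 \<le> (\<integral>x. psi (f x) \<partial>lborel)"
    using psi_nonneg[OF fm] by (intro integral_nonneg_AE) auto
  ultimately show ?thesis by simp
qed

lemma entropy_nonneg: "perturbation L f \<Longrightarrow> 0 \<le> (\<integral>x. psi (f x) \<partial>lborel)"
  by (intro integral_nonneg_AE) (auto intro!: psi_nonneg simp: perturbation_def)

text \<open>Uniqueness fails in two ways: some density lies strictly below \<open>rho0\<close>,
  which gives negative excess, or there is a second minimizer, whose perturbation is not almost
  everywhere 0 and so has positive entropy.\<close>

lemma not_unique_perturbation:
  assumes "\<not> unique_min_rho0 L V \<theta>"
  shows "\<exists>f. perturbation L f \<and> excess \<theta> f \<le> 0 \<and> (excess \<theta> f < 0 \<or> 0 < (\<integral>x. psi (f x) \<partial>lborel))"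
proof -
  have rep: "\<exists>f. perturbation L f \<and> represents f \<rho>"
    if \<rho>: "\<rho> \<in> densities L" "free_energy L V \<theta> \<rho> \<le> free_energy L V \<theta> (rho0 L)" for \<rho>
  proof -
    obtain f where f: "represents f \<rho>" using density_represented[OF \<rho>(1)] by auto
    have "free_energy L V \<theta> \<rho> \<noteq> \<infinity>" using \<rho>(2) by (auto simp: free_energy_rho0)
    then have "integrable (lebesgue_on (torus_box L)) (\<lambda>x. \<rho> x * ln (\<rho> x))"
      by (auto simp: free_energy_def split: if_splits)
    then show ?thesis using density_entropy(1,3)[OF f \<rho>(1)] f by auto
  qed
  show ?thesis
  proof (cases "is_minimizer L V \<theta> (rho0 L)")
    case False
    then obtain \<rho> where \<rho>: "\<rho> \<in> densities L" "free_energy L V \<theta> \<rho> < free_energy L V \<theta> (rho0 L)"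
      using rho0_density by (auto simp: is_minimizer_def not_le)
    then show ?thesis using rep[OF \<rho>(1) less_imp_le[OF \<rho>(2)]] free_energy_le_rho0_iff(2) less_imp_le by blast
  next
    case True
    then obtain \<rho> where \<rho>: "is_minimizer L V \<theta> \<rho>" "\<not> same_density L \<rho> (rho0 L)"
      using assms by (auto simp: unique_min_rho0_def)
    then have d: "\<rho> \<in> densities L" and le: "free_energy L V \<theta> \<rho> \<le> free_energy L V \<theta> (rho0 L)"
      using rho0_density by (auto simp: is_minimizer_def)
    then obtain f where f: "perturbation L f" "represents f \<rho>" using rep by blast
    have "\<not> (AE x in lborel. f x = 0)"
    proof
      assume "AE x in lborel. f x = 0"
      moreover have "AE x in lborel. x \<in> torus_box L \<longrightarrow> \<rho> x = (1 + f x) / L ^ CARD('n)"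
        using f(2) by (simp add: represents_def)
      ultimately have "AE x in lborel. x \<in> torus_box L \<longrightarrow> \<rho> x = rho0 L x"
        by eventually_elim (auto simp: rho0_def)
      then have "same_density L \<rho> (rho0 L)"
        unfolding same_density_def
        by (subst AE_restrict_space_iff) (auto simp: torus_box_def dest: AE_completion)
      then show False using \<rho>(2) by simp
    qed
    then show ?thesis
      using f d le free_energy_le_rho0_iff(1)[OF f(1) d f(2)] entropy_pos[OF f(1)] by blast
  qed
qed

text \<open>The excess is affine in the coupling. As the entropy is nonnegative, either alternative
  of \<open>not_unique_perturbation\<close> forces a negative interaction, so the excess strictly
  decreases as the coupling grows. Strict negativity is what survives tiling.\<close>

lemma not_unique_imp_negative_excess:
  assumes "\<not> unique_min_rho0 L V \<theta>" "0 \<le> \<theta>" "\<theta> < \<theta>'"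
  shows "\<exists>f. perturbation L f \<and> excess \<theta>' f < 0"
proof -
  obtain f where f: "perturbation L f" "excess \<theta> f \<le> 0" "excess \<theta> f < 0 \<or> 0 < (\<integral>x. psi (f x) \<partial>lborel)"
    using not_unique_perturbation[OF assms(1)] by blast
  let ?I = "pairing U f (wrap L f)"
  have "\<theta> * ?I < 0" using f entropy_nonneg[OF f(1)] by (auto simp: excess_def)
  then have "?I < 0" using assms(2) by (simp add: mult_less_0_iff)
  then have "\<theta>' * ?I < \<theta> * ?I" using assms(3) by simp
  then show ?thesis using f by (auto simp: excess_def intro!: exI[of _ f])
qed

text \<open>Condition K speaks of probability densities, the splitting argument of arbitrary
  nonnegative \<open>g\<close>. Dividing by the total mass bridges the gap; zero mass means
  \<open>g = 0\<close> almost everywhere.\<close>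

lemma pairing_nonneg:
  assumes K: "\<And>\<rho>. \<rho> \<in> densities L \<Longrightarrow> 0 \<le> interaction L V \<rho>"
    and g: "integrable lborel g" "\<And>x. 0 \<le> g x" "\<And>x. x \<notin> cell L \<Longrightarrow> g x = 0"
  shows "0 \<le> pairing U g (wrap L g)"
proof (cases "(\<integral>x. g x \<partial>lborel) = 0")
  case True
  then have "AE x in lborel. g x = 0" using g by (subst (asm) integral_nonneg_eq_0_iff_AE) auto
  then have "(\<integral>y. (\<integral>x. U (x - y) * wrap L g x \<partial>lborel) * g y \<partial>lborel) = 0"
    by (intro integral_eq_zero_AE) auto
  then show ?thesis
    by (subst pairing_Fubini(2)) (auto intro!: g integrable_wrap short_rangeD(1)[OF U])
next
  case False
  define s where "s = (\<integral>x. g x \<partial>lborel)"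
  have "0 \<le> s" unfolding s_def using g by (intro integral_nonneg_AE) auto
  then have s: "0 < s" using False by (simp add: s_def)
  note [measurable] = integrable_lborel_imp_borel[OF g(1)]
  let ?r = "\<lambda>x. 1 / s * g x"
  have r: "integrable lborel ?r" "\<And>x. x \<notin> cell L \<Longrightarrow> ?r x = 0" using g by auto
  have ae: "AE x in lborel. x \<in> torus_box L \<longrightarrow> ?r x = ?r x" by simp
  have "integrable (lebesgue_on (torus_box L)) ?r"
    by (rule torus_integral(1)[OF _ _ ae, THEN iffD2]) (use r in auto)
  moreover have "integral\<^sup>L (lebesgue_on (torus_box L)) ?r = 1"
    by (subst torus_integral(2)[OF _ _ ae]) (use r s g in \<open>auto simp: s_def[symmetric]\<close>)
  ultimately have "?r \<in> densities L"
    using g(2) s by (auto simp: densities_def)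
  from K[OF this] have "0 \<le> pairing U ?r (wrap L ?r)"
    using interaction_eq[OF r ae] by simp
  then have "0 \<le> 1 / s * (1 / s * pairing U g (wrap L g))"
    by (simp only: wrap_scale pairing_scale_left pairing_scale_right)
  then show ?thesis using s by (auto simp: zero_le_divide_iff mult_le_0_iff)
qed

text \<open>Multiplying \<open>interaction_lower_bound\<close> by \<open>\<theta> / 2\<close> gives
  \<open>excess \<theta> f \<ge> (1 - 9 * \<theta> * A) * E\<close> with entropy \<open>E\<close>,
  which excludes both alternatives of \<open>not_unique_perturbation\<close>. The threshold does not
  depend on \<open>L\<close>.\<close>

lemma unique_small_coupling:
  assumes K: "\<And>\<rho>. \<rho> \<in> densities L \<Longrightarrow> 0 \<le> interaction L V \<rho>"
    and \<theta>: "0 \<le> \<theta>" "9 * \<theta> * (\<integral>z. \<bar>U z\<bar> \<partial>lborel) < 1"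
  shows "unique_min_rho0 L V \<theta>"
proof (rule ccontr)
  assume "\<not> unique_min_rho0 L V \<theta>"
  then obtain f where f: "perturbation L f" "excess \<theta> f \<le> 0" "excess \<theta> f < 0 \<or> 0 < (\<integral>x. psi (f x) \<partial>lborel)"
    using not_unique_perturbation by blast
  define A where "A = (\<integral>z. \<bar>U z\<bar> \<partial>lborel)"
  define E where "E = (\<integral>x. psi (f x) \<partial>lborel)"
  have "- (18 * A * E) \<le> pairing U f (wrap L f)"
    unfolding A_def E_def
    by (rule interaction_lower_bound[OF U L _ f(1)]) (rule pairing_nonneg[OF K])
  then have "\<theta> / 2 * (- (18 * A * E)) \<le> \<theta> / 2 * pairing U f (wrap L f)"
    using \<theta> by (intro mult_left_mono) auto
  then have "(1 - 9 * \<theta> * A) * E \<le> excess \<theta> f"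
    by (simp add: excess_def E_def algebra_simps)
  moreover have "0 \<le> (1 - 9 * \<theta> * A) * E" and "0 < E \<Longrightarrow> 0 < (1 - 9 * \<theta> * A) * E"
    using \<theta> entropy_nonneg[OF f(1)] by (auto simp: E_def A_def)
  ultimately show False using f by (auto simp: E_def)
qed

end

section \<open>Negative Fourier coefficients\<close>

lemma AE_lborel_shift:
  fixes P :: "'a::euclidean_space \<Rightarrow> bool"
  assumes "AE y in lborel. P y"
  shows "AE y in lborel. P (y + s)"
  using AE_lborel_reflect[OF AE_lborel_reflect[OF assms, of 0], of "- s"] by (simp add: add.commute)

lemma psi_le_square: "- 1 < t \<Longrightarrow> psi t \<le> t\<^sup>2"
  using mult_left_mono[OF ln_add_one_self_le_self2[of t], of "1 + t"]
  by (simp add: psi_def power2_eq_square algebra_simps)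

lemma wrap_periodic:
  assumes "\<And>x m. g (x + lat L m) = g x"
  shows "wrap L (\<lambda>x. g x * h x) x = g x * wrap L h x"
  using assms[of "x - lat L m" m for m] by (simp add: wrap_def sum_distrib_left)

text \<open>The shifted cell is cut along the lattice translates of the cell, and each piece is
  moved back without changing the periodic \<open>g\<close>. A shift that negates \<open>g\<close>
  will thus give mean zero.\<close>

lemma integral_cell_shift:
  fixes g :: "real^'n \<Rightarrow> real"
  assumes L: "0 < L" and g [measurable]: "g \<in> borel_measurable borel" and b: "\<And>x. \<bar>g x\<bar> \<le> 1"
    and per: "\<And>x m. g (x + lat L m) = g x" and s: "\<And>i. \<bar>s $ i\<bar> \<le> L"
  shows "(\<integral>x. g (x + s) * indicator (cell L) x \<partial>lborel) = (\<integral>x. g x * indicator (cell L) x \<partial>lborel)"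
proof -
  let ?c = "indicator (cell L) :: real^'n \<Rightarrow> real"
  have i: "integrable lborel (\<lambda>x. g x * (?c (x - p) * ?c (x - q)))" for p q
  proof (rule Bochner_Integration.integrable_bound)
    show "integrable lborel (\<lambda>x. ?c (x - p))" by (rule integrable_lborel_shift) simp
    show "AE x in lborel. norm (g x * (?c (x - p) * ?c (x - q))) \<le> norm (?c (x - p))"
      using b by (auto simp: indicator_def)
  qed measurable
  have near: "wrap L ?c x = 1" if "x - t \<in> cell L" "\<And>i. \<bar>t $ i\<bar> \<le> L" for x t
  proof (rule wrap_indicator[OF L])
    fix i
    have "0 \<le> x $ i - t $ i" "x $ i - t $ i < L" using that(1) by (auto simp: cell_def)
    then show "- L \<le> x $ i" "x $ i < 2 * L" using that(2)[of i] by auto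
  qed
  have "(\<integral>x. g (x + s) * ?c x \<partial>lborel) = (\<integral>x. g (x - s + s) * ?c (x - s) \<partial>lborel)"
    by (rule integral_lborel_shift[symmetric]) measurable
  also have "\<dots> = (\<integral>x. (\<Sum>m\<in>neighbours. g x * (?c (x - s) * ?c (x - lat L m))) \<partial>lborel)"
  proof (rule Bochner_Integration.integral_cong[OF refl])
    fix x
    have "?c (x - s) * wrap L ?c x = ?c (x - s)" using near[OF _ s, of x] by (auto simp: indicator_def)
    then show "g (x - s + s) * ?c (x - s) = (\<Sum>m\<in>neighbours. g x * (?c (x - s) * ?c (x - lat L m)))"
      by (simp add: wrap_def flip: sum_distrib_left)
  qed
  also have "\<dots> = (\<Sum>m\<in>neighbours. (\<integral>x. g x * (?c (x - s) * ?c (x - lat L m)) \<partial>lborel))"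
    by (intro Bochner_Integration.integral_sum i)
  also have "\<dots> = (\<Sum>m\<in>neighbours. (\<integral>x. g x * (?c (x - s - lat L m) * ?c x) \<partial>lborel))"
  proof -
    have "(\<integral>x. g x * (?c (x - s) * ?c (x - lat L (- m))) \<partial>lborel)
        = (\<integral>x. g x * (?c (x - s - lat L m) * ?c x) \<partial>lborel)" for m
    proof -
      have "(\<integral>x. g x * (?c (x - s) * ?c (x - lat L (- m))) \<partial>lborel)
          = (\<integral>x. g (x - lat L m) * (?c (x - lat L m - s) * ?c (x - lat L m - lat L (- m))) \<partial>lborel)"
        by (rule integral_lborel_shift[symmetric]) measurable
      moreover have "g (x - lat L m) = g x" for x using per[of "x - lat L m" m] by simp
      ultimately show ?thesis by (simp add: lat_uminus algebra_simps)
    qed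
    then show ?thesis
      by (subst sum.reindex_bij_betw[OF uminus_neighbours, symmetric]) simp
  qed
  also have "\<dots> = (\<integral>x. (\<Sum>m\<in>neighbours. g x * (?c (x - s - lat L m) * ?c x)) \<partial>lborel)"
    using i[of "s + lat L m" 0 for m] by (intro Bochner_Integration.integral_sum[symmetric]) (simp add: diff_diff_eq)
  also have "\<dots> = (\<integral>x. g x * ?c x \<partial>lborel)"
  proof (rule Bochner_Integration.integral_cong[OF refl])
    fix x
    have "wrap L ?c (x - s) * ?c x = ?c x"
      using near[of "x - s" "- s"] s by (auto simp: indicator_def)
    then show "(\<Sum>m\<in>neighbours. g x * (?c (x - s - lat L m) * ?c x)) = g x * ?c x"
      by (simp add: wrap_def flip: sum_distrib_left sum_distrib_right)
  qed
  finally show ?thesis .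
qed

context potential
begin

text \<open>Near the cell the wrapped function is \<open>g\<close> itself by periodicity, so the
  inner integral is the correlation with \<open>U\<close>, for which \<open>g\<close> is an
  eigenfunction with eigenvalue \<open>r\<close>.\<close>

lemma pairing_periodic:
  assumes g [measurable]: "g \<in> borel_measurable borel" and b: "\<And>x. \<bar>g x\<bar> \<le> 1"
    and per: "\<And>x m. g (x + lat L m) = g x"
    and eig: "\<And>y. (\<integral>z. U z * g (z + y) \<partial>lborel) = r * g y"
  shows "pairing U (\<lambda>x. g x * indicator (cell L) x) (wrap L (\<lambda>x. g x * indicator (cell L) x))
    = r * (\<integral>x. (g x)\<^sup>2 * indicator (cell L) x \<partial>lborel)"
proof -
  let ?c = "indicator (cell L) :: real^'n \<Rightarrow> real"
  have i: "integrable lborel (\<lambda>x. g x * ?c x)"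
    by (rule Bochner_Integration.integrable_bound[OF integrable_indicator_cell[of L]])
      (use b in \<open>auto simp: indicator_def\<close>)
  have "(\<integral>x. U (x - y) * wrap L (\<lambda>x. g x * ?c x) x \<partial>lborel) * (g y * ?c y) = r * ((g y)\<^sup>2 * ?c y)" for y
  proof (cases "y \<in> cell L")
    case True
    have "U (x - y) * wrap L (\<lambda>x. g x * ?c x) x = U (x - y) * g ((x - y) + y)" for x
      using wrap_near[OF L True, of x] short_rangeD(2)[OF U, of "x - y"]
      by (cases "norm (x - y) \<le> a") (auto simp: wrap_periodic[of g L, OF per])
    moreover have "(\<integral>x. U (x - y) * g ((x - y) + y) \<partial>lborel) = r * g y"
      using integral_lborel_shift[of "\<lambda>z. U z * g (z + y)" y] eig by simp
    ultimately have "(\<integral>x. U (x - y) * wrap L (\<lambda>x. g x * ?c x) x \<partial>lborel) = r * g y"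
      by (simp only:)
    then show ?thesis using True by (simp add: power2_eq_square)
  qed auto
  then have "(\<integral>y. (\<integral>x. U (x - y) * wrap L (\<lambda>x. g x * ?c x) x \<partial>lborel) * (g y * ?c y) \<partial>lborel)
      = r * (\<integral>x. (g x)\<^sup>2 * ?c x \<partial>lborel)"
    by (simp only: integral_mult_right_zero)
  then show ?thesis
    by (subst pairing_Fubini(2)) (auto intro!: i integrable_wrap short_rangeD(1)[OF U])
qed

text \<open>Unfolding: the character is lattice periodic, so summing the images over the cell
  amounts to integrating over the whole space. The translates of the cell by
  \<open>neighbours\<close> already cover the range of \<open>U\<close> exactly once.\<close>

lemma fourier_coeff_eq:
  assumes k: "\<And>x m. cis (- (k \<bullet> (x + lat L m))) = cis (- (k \<bullet> x))"
  shows "fourier_coeff L V k = (\<integral>z. complex_of_real (U z) * cis (- (k \<bullet> z)) \<partial>lborel)"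
proof -
  let ?c = "indicator (cell L) :: real^'n \<Rightarrow> real"
  let ?h = "\<lambda>z. complex_of_real (U z) * cis (- (k \<bullet> z))"
  have cm [measurable]: "(\<lambda>z. cis (- (k \<bullet> z))) \<in> borel_measurable borel"
    by (intro borel_measurable_continuous_onI continuous_intros)
  have h: "integrable lborel ?h"
    by (rule Bochner_Integration.integrable_bound[OF short_range_integrable[OF U]])
      (auto simp: norm_mult)
  have hc: "integrable lborel (\<lambda>z. ?h z * complex_of_real (?c (z - p)))" for p
    by (rule Bochner_Integration.integrable_bound[OF h]) (auto simp: norm_mult indicator_def)
  have "AE x in lborel. \<forall>m\<in>neighbours. V (x + lat L m) = U (x + lat L m)"
    by (intro AE_finite_allI finite_neighbours AE_lborel_shift VU)
  then have "AE x in lborel. x \<in> torus_box L \<longrightarrow> complex_of_real (periodize L V x) * cis (- (k \<bullet> x))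
      = (\<Sum>m\<in>neighbours. ?h (x + lat L m) * complex_of_real (?c x))"
    using AE_torus_box_cell[of L]
  proof eventually_elim
    case (elim x)
    show ?case
    proof
      assume x: "x \<in> torus_box L"
      have "\<bar>x $ i\<bar> \<le> L" for i
      proof -
        have "0 \<le> x $ i" "x $ i \<le> L" using x by (auto simp: torus_box_def mem_box_cart)
        then show ?thesis by simp
      qed
      from periodize_finite[where V = V, OF V0 L this] elim x
      show "complex_of_real (periodize L V x) * cis (- (k \<bullet> x))
          = (\<Sum>m\<in>neighbours. ?h (x + lat L m) * complex_of_real (?c x))"
        by (simp add: k sum_distrib_right)
    qed
  qed
  then have "fourier_coeff L V k = (\<integral>x. (\<Sum>m\<in>neighbours. ?h (x + lat L m) * complex_of_real (?c x)) \<partial>lborel)"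
    unfolding fourier_coeff_def by (intro torus_integral(2)) auto
  also have "\<dots> = (\<Sum>m\<in>neighbours. (\<integral>x. ?h (x + lat L m) * complex_of_real (?c x) \<partial>lborel))"
    using integrable_lborel_shift[OF hc, of "- lat L m" "lat L m" for m]
    by (intro Bochner_Integration.integral_sum) simp
  also have "\<dots> = (\<Sum>m\<in>neighbours. (\<integral>z. ?h z * complex_of_real (?c (z - lat L m)) \<partial>lborel))"
    using integral_lborel_shift[OF integrable_lborel_imp_borel[OF hc], of "- lat L m" "lat L m" for m] by simp
  also have "\<dots> = (\<integral>z. (\<Sum>m\<in>neighbours. ?h z * complex_of_real (?c (z - lat L m))) \<partial>lborel)"
    by (intro Bochner_Integration.integral_sum[symmetric] hc)
  also have "\<dots> = (\<integral>z. ?h z \<partial>lborel)"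
  proof (rule Bochner_Integration.integral_cong[OF refl])
    fix z
    have "complex_of_real (wrap L ?c z) = 1" if "norm z \<le> a"
      using wrap_near[OF L, of 0 z] that L by (simp add: cell_def)
    then show "(\<Sum>m\<in>neighbours. ?h z * complex_of_real (?c (z - lat L m))) = ?h z"
      using short_rangeD(2)[OF U, of z]
      by (cases "norm z \<le> a") (auto simp: wrap_def simp flip: sum_distrib_left)
  qed
  finally show ?thesis .
qed

text \<open>The shift makes the integral over the cell equal to its own negative. The factor 1/2
  keeps the values strictly above -1, where \<open>psi_le_square\<close> applies.\<close>

lemma perturbation_periodic:
  fixes g :: "real^'n \<Rightarrow> real"
  assumes g [measurable]: "g \<in> borel_measurable borel" and b: "\<And>x. \<bar>g x\<bar> \<le> 1"
    and per: "\<And>x m. g (x + lat L m) = g x"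
    and s: "\<And>x. g (x + s) = - g x" "\<And>i. \<bar>s $ i\<bar> \<le> L"
  shows "perturbation L (\<lambda>x. 1 / 2 * (g x * indicator (cell L) x))"
proof -
  let ?c = "indicator (cell L) :: real^'n \<Rightarrow> real"
  let ?f = "\<lambda>x. 1 / 2 * (g x * ?c x)"
  have i: "integrable lborel (\<lambda>x. g x * ?c x)"
    by (rule Bochner_Integration.integrable_bound[OF integrable_indicator_cell[of L]])
      (use b in \<open>auto simp: indicator_def\<close>)
  have m: "(\<integral>x. g x * ?c x \<partial>lborel) = 0"
    using integral_cell_shift[OF L_pos g b per s(2)] by (simp add: s(1))
  have fb: "\<bar>?f x\<bar> \<le> 1 / 2 * ?c x" for x using b[of x] by (auto simp: indicator_def)
  have fm: "- 1 < ?f x" for x using fb[of x] by (auto simp: indicator_def split: if_splits)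
  have "integrable lborel (\<lambda>x. psi (?f x))"
  proof (rule Bochner_Integration.integrable_bound[OF integrable_indicator_cell[of L]])
    have "norm (psi (?f x)) \<le> norm (?c x)" for x
    proof (cases "x \<in> cell L")
      case True
      have "(?f x)\<^sup>2 \<le> 1" using fb[of x] True by (simp add: abs_square_le_1)
      then show ?thesis
        using psi_le_square[OF fm[of x]] psi_nonneg[OF less_imp_le[OF fm[of x]]] True by simp
    qed simp
    then show "AE x in lborel. norm (psi (?f x)) \<le> norm (?c x)" by simp
  qed measurable
  then show ?thesis using i m less_imp_le[OF fm] by (auto simp: perturbation_def)
qed

text \<open>Cosine and sine of \<open>k \<bullet> x\<close> are eigenfunctions with eigenvalue
  \<open>r < 0\<close>. Their squares sum to 1, so their interactions add up to \<open>r\<close>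
  times the volume of the cell and at least one is negative; a large coupling lets it outweigh the
  entropy.\<close>

lemma in_VN_negative_excess:
  assumes "in_VN L V"
  shows "\<exists>\<theta>\<ge>0. \<exists>f. perturbation L f \<and> excess \<theta> f < 0"
proof -
  obtain k r where k: "k \<in> dual_lattice L" "k \<noteq> 0" and r: "r < 0" "fourier_coeff L V k = complex_of_real r"
    using assms by (auto simp: in_VN_def)
  obtain m :: "int^'n" where m: "k = (\<chi> i. 2 * pi / L * of_int (m $ i))"
    using k(1) by (auto simp: dual_lattice_def)
  have kl: "k \<bullet> lat L j = 2 * pi * of_int (\<Sum>i\<in>UNIV. m $ i * j $ i)" for j :: "int^'n"
    using L_pos by (simp add: m inner_vec_def sum_distrib_left mult.assoc)
  have cs: "cos (k \<bullet> (x + lat L j)) = cos (k \<bullet> x)" "sin (k \<bullet> (x + lat L j)) = sin (k \<bullet> x)" for x and j :: "int^'n"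
    by (simp_all add: inner_add_right kl cos_add sin_add cos_int_2pin sin_int_2pin del: of_int_sum)
  have cisk: "cis (- (k \<bullet> (x + lat L j))) = cis (- (k \<bullet> x))" for x j
    by (simp add: complex_eq_iff cs)
  obtain i where i: "k $ i \<noteq> 0" using k(2) by (auto simp: vec_eq_iff)
  \<comment> \<open>Half a wavelength along a coordinate in which \<open>k\<close> is nonzero:
    \<open>k \<bullet> s = pi\<close>, so the shift negates both waves, and its length
    \<open>L / (2 * \<bar>m $ i\<bar>)\<close> is at most \<open>L\<close>.\<close>
  define s :: "real^'n" where "s = axis i (pi / k $ i)"
  have ks: "k \<bullet> s = pi" using i by (simp add: s_def inner_axis)
  have mi: "m $ i \<noteq> 0" using i by (auto simp: m)
  have sb: "\<bar>s $ j\<bar> \<le> L" for j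
  proof -
    have "1 \<le> \<bar>real_of_int (m $ i)\<bar>" using mi by linarith
    then have "\<bar>pi / k $ i\<bar> \<le> L" using L_pos mi by (simp add: m abs_mult abs_divide field_simps)
    then show ?thesis using L_pos by (auto simp: s_def axis_def)
  qed
  have [measurable]: "(\<lambda>x. cos (k \<bullet> x)) \<in> borel_measurable borel" "(\<lambda>x. sin (k \<bullet> x)) \<in> borel_measurable borel"
    by (intro borel_measurable_continuous_onI continuous_intros)+
  have cism [measurable]: "(\<lambda>z. cis (- (k \<bullet> z))) \<in> borel_measurable borel"
    by (intro borel_measurable_continuous_onI continuous_intros)
  note iU = short_range_integrable[OF U]
  have ih: "integrable lborel (\<lambda>z. complex_of_real (U z) * cis (- (k \<bullet> z)))"
    by (rule Bochner_Integration.integrable_bound[OF iU]) (auto simp: norm_mult)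
  have ic: "integrable lborel (\<lambda>z. U z * cos (k \<bullet> z))" and isn: "integrable lborel (\<lambda>z. U z * sin (k \<bullet> z))"
    by (rule Bochner_Integration.integrable_bound[OF iU], auto simp: abs_mult mult_left_le)+
  have "(\<integral>z. complex_of_real (U z) * cis (- (k \<bullet> z)) \<partial>lborel) = complex_of_real r"
    using fourier_coeff_eq[OF cisk] r(2) by simp
  \<comment> \<open>The coefficient is real, so its imaginary part makes the sine integral vanish;
    the addition theorems then turn both waves into eigenfunctions.\<close>
  then have Uc: "(\<integral>z. U z * cos (k \<bullet> z) \<partial>lborel) = r" and Us: "(\<integral>z. U z * sin (k \<bullet> z) \<partial>lborel) = 0"
    using integral_Re[OF ih] integral_Im[OF ih] by simp_all
  have ec: "(\<integral>z. U z * cos (k \<bullet> (z + y)) \<partial>lborel) = r * cos (k \<bullet> y)" for y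
  proof -
    have "(\<integral>z. U z * cos (k \<bullet> (z + y)) \<partial>lborel)
        = (\<integral>z. U z * cos (k \<bullet> z) * cos (k \<bullet> y) - U z * sin (k \<bullet> z) * sin (k \<bullet> y) \<partial>lborel)"
      by (simp add: inner_add_right cos_add algebra_simps)
    then show ?thesis using ic isn Uc Us by simp
  qed
  have es: "(\<integral>z. U z * sin (k \<bullet> (z + y)) \<partial>lborel) = r * sin (k \<bullet> y)" for y
  proof -
    have "(\<integral>z. U z * sin (k \<bullet> (z + y)) \<partial>lborel)
        = (\<integral>z. U z * sin (k \<bullet> z) * cos (k \<bullet> y) + U z * cos (k \<bullet> z) * sin (k \<bullet> y) \<partial>lborel)"
      by (simp add: inner_add_right sin_add algebra_simps)
    then show ?thesis using ic isn Uc Us by simp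
  qed
  let ?c = "indicator (cell L) :: real^'n \<Rightarrow> real"
  let ?C = "\<lambda>x. cos (k \<bullet> x)" and ?S = "\<lambda>x. sin (k \<bullet> x)"
  let ?I = "\<lambda>g. pairing U (\<lambda>x. g x * ?c x) (wrap L (\<lambda>x. g x * ?c x))"
  have isq: "integrable lborel (\<lambda>x. (?C x)\<^sup>2 * ?c x)" "integrable lborel (\<lambda>x. (?S x)\<^sup>2 * ?c x)"
    by (rule Bochner_Integration.integrable_bound[OF integrable_indicator_cell[of L]],
        auto simp: indicator_def abs_square_le_1)+
  have "?I ?C + ?I ?S = r * ((\<integral>x. (?C x)\<^sup>2 * ?c x \<partial>lborel) + (\<integral>x. (?S x)\<^sup>2 * ?c x \<partial>lborel))"
    using pairing_periodic[of ?C r] pairing_periodic[of ?S r] cs ec es by (simp add: distrib_left)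
  also have "(\<integral>x. (?C x)\<^sup>2 * ?c x \<partial>lborel) + (\<integral>x. (?S x)\<^sup>2 * ?c x \<partial>lborel) = (\<integral>x. ?c x \<partial>lborel)"
    by (subst Bochner_Integration.integral_add[OF isq, symmetric]) (simp flip: distrib_right)
  also have "r * (\<integral>x. ?c x \<partial>lborel) < 0"
    unfolding integral_indicator_cell using r L_pos by (intro mult_neg_pos) auto
  finally have "?I ?C < 0 \<or> ?I ?S < 0" by linarith
  moreover have "perturbation L (\<lambda>x. 1 / 2 * (?C x * ?c x))"
    by (rule perturbation_periodic[where s = s]) (auto simp: cs sb inner_add_right[of k _ s] ks)
  moreover have "perturbation L (\<lambda>x. 1 / 2 * (?S x * ?c x))"
    by (rule perturbation_periodic[where s = s]) (auto simp: cs sb inner_add_right[of k _ s] ks)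
  ultimately have "\<exists>g\<in>{?C, ?S}. perturbation L (\<lambda>x. 1 / 2 * (g x * ?c x)) \<and> ?I g < 0"
    by (simp only: bex_simps) blast
  then obtain g where "perturbation L (\<lambda>x. 1 / 2 * (g x * ?c x)) \<and> ?I g < 0" by (rule bexE)
  then have g: "perturbation L (\<lambda>x. 1 / 2 * (g x * ?c x))" "?I g < 0" by (rule conjunct1, rule conjunct2)
  define f where "f = (\<lambda>x. 1 / 2 * (g x * ?c x))"
  have "pairing U f (wrap L f) = 1 / 2 * (1 / 2 * ?I g)"
    by (simp only: f_def wrap_scale pairing_scale_left pairing_scale_right)
  then have I: "pairing U f (wrap L f) < 0" using g(2) by simp
  define E where "E = (\<integral>x. psi (f x) \<partial>lborel)"
  have pf: "perturbation L f" using g(1) by (simp add: f_def)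
  \<comment> \<open>Chosen so that the interaction term is \<open>- (E + 1)\<close> and the excess
    is -1.\<close>
  define \<theta> where "\<theta> = 2 * (E + 1) / (- pairing U f (wrap L f))"
  have "0 \<le> \<theta>" unfolding \<theta>_def E_def using entropy_nonneg[OF pf] I by (intro divide_nonneg_pos) auto
  moreover have "excess \<theta> f < 0" using I by (simp add: excess_def \<theta>_def E_def[symmetric] field_simps)
  ultimately show ?thesis using pf by blast
qed

end

section \<open>Convergence of the transition points\<close>

lemma short_range_representative:
  assumes V: "V \<in> borel_measurable lebesgue" "\<And>x. \<bar>V x\<bar> \<le> C" "\<And>z. a < norm z \<Longrightarrow> V z = 0"
  shows "\<exists>U. short_range a U \<and> (AE z in lborel. V z = U z)"
proof -
  obtain W where W: "W \<in> borel_measurable lborel" "AE z in lborel. V z = W z"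
    using completion_ex_borel_measurable_real[OF V(1)] by blast
  have [measurable]: "W \<in> borel_measurable borel" using W(1) by simp
  \<comment> \<open>Clipping to \<open>[- C, C]\<close> and to the ball makes bound and range hold
    at every point, and alters \<open>W\<close> only where it differs from \<open>V\<close>.\<close>
  define U where "U z = (if norm z \<le> a then max (- C) (min C (W z)) else 0)" for z
  have "U \<in> borel_measurable borel" unfolding U_def by measurable
  moreover have "0 \<le> C" using V(2)[of 0] by linarith
  then have "\<bar>U z\<bar> \<le> C" for z by (auto simp: U_def)
  moreover have "AE z in lborel. V z = U z"
    using W(2)
  proof eventually_elim
    case (elim z)
    then show ?case using V(2)[of z] V(3)[of z] by (auto simp: U_def)
  qed
  moreover have "U z = 0" if "a < norm z" for z using that by (simp add: U_def)
  ultimately show ?thesis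
    by (intro exI[of _ U]) (auto simp: short_range_def bounded_borel_def)
qed

text \<open>In the spirit of Fekete's lemma: every single value \<open>t L\<close> bounds the later
  values up to an arbitrarily small error, so the upper limit is at most the infimum, which is
  itself a lower bound from \<open>M\<close> on.\<close>

lemma tendsto_Inf_of_eventually_le:
  fixes t :: "real \<Rightarrow> real"
  assumes low: "\<And>L. M \<le> L \<Longrightarrow> c \<le> t L"
    and ev: "\<And>L \<theta>. M \<le> L \<Longrightarrow> t L < \<theta> \<Longrightarrow> \<forall>\<^sub>F L' in at_top. t L' \<le> \<theta>"
  shows "(t \<longlongrightarrow> Inf (t ` {M..})) at_top" "c \<le> Inf (t ` {M..})"
proof -
  let ?l = "Inf (t ` {M..})"
  show "c \<le> ?l" using low by (intro cInf_greatest) auto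
  have bdd: "bdd_below (t ` {M..})" using low by (intro bdd_belowI[of _ c]) auto
  show "(t \<longlongrightarrow> ?l) at_top"
  proof (rule order_tendstoI)
    fix b assume b: "b < ?l"
    show "\<forall>\<^sub>F L in at_top. b < t L"
      using eventually_ge_at_top[of M]
      by eventually_elim (auto intro!: less_le_trans[OF b cInf_lower[OF _ bdd]])
  next
    fix b assume b: "?l < b"
    then obtain L where L: "M \<le> L" "t L < (?l + b) / 2"
      using cInf_lessD[of "t ` {M..}" "(?l + b) / 2"] by auto
    from ev[OF L] show "\<forall>\<^sub>F L in at_top. t L < b"
      by eventually_elim (use b in auto)
  qed
qed

theorem theorem3p2:
  fixes V :: "real^'n \<Rightarrow> real"
  assumes "class_V V"
    and "\<exists>L0. \<forall>L\<ge>L0. in_VN L V"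
    and "condition_K V"
    and "\<exists>L0. \<forall>L\<ge>L0. \<not> lower_critical L V (lower_transition L V)"
  shows "\<exists>l>0. ((\<lambda>L. lower_transition L V) \<longlongrightarrow> l) at_top"
proof -
  obtain a0 where "\<And>x. a0 < norm x \<Longrightarrow> V x = 0" and Vm: "V \<in> borel_measurable lebesgue"
    using assms(1) by (auto simp: class_V_def)
  moreover define a where "a = max a0 0"
  ultimately have V0: "\<And>x. a < norm x \<Longrightarrow> V x = 0" by simp
  obtain C where C: "\<And>x. \<bar>V x\<bar> \<le> C"
    using assms(3) by (auto simp: condition_K_def)
  obtain L2 where "\<forall>L\<ge>L2. \<forall>\<rho>\<in>densities L. 0 \<le> interaction L V \<rho>"
    using assms(3) unfolding condition_K_def by blast
  then have K: "\<And>L \<rho>. L2 \<le> L \<Longrightarrow> \<rho> \<in> densities L \<Longrightarrow> 0 \<le> interaction L V \<rho>"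
    by blast
  obtain L1 where VN: "\<And>L. L1 \<le> L \<Longrightarrow> in_VN L V" using assms(2) by auto
  obtain U where U: "short_range a U" "AE z in lborel. V z = U z"
    using short_range_representative[where a = a, OF Vm C V0] by blast
  define M where "M = Max {a + 1, L1, L2}"
  have pot: "potential V U a L" if "M \<le> L" for L
    using that U V0 by unfold_locales (auto simp: M_def a_def)
  define S where "S L = {\<theta>. 0 \<le> \<theta> \<and> (\<forall>\<theta>'. 0 \<le> \<theta>' \<and> \<theta>' \<le> \<theta> \<longrightarrow> unique_min_rho0 L V \<theta>')}" for L
  have tS: "lower_transition L V = Sup (S L)" for L
    by (simp add: lower_transition_def S_def)
  define A where "A = (\<integral>z. \<bar>U z\<bar> \<partial>lborel)"
  \<comment> \<open>Gives \<open>9 * c * A < 1\<close> for every \<open>A \<ge> 0\<close> and is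
    independent of \<open>L\<close>, which keeps all transition points away from 0.\<close>
  define c where "c = 1 / (9 * A + 1)"
  have A: "0 \<le> A" by (simp add: A_def)
  then have c: "0 < c" "9 * c * A < 1" by (auto simp: c_def field_simps)
  have cS: "c \<in> S L" if "M \<le> L" for L
  proof -
    have "unique_min_rho0 L V \<theta>" if \<theta>: "0 \<le> \<theta>" "\<theta> \<le> c" for \<theta>
    proof (rule potential.unique_small_coupling[OF pot[OF \<open>M \<le> L\<close>] K \<theta>(1)])
      have "9 * \<theta> * A \<le> 9 * c * A" using \<theta> A by (intro mult_right_mono) auto
      then show "9 * \<theta> * (\<integral>z. \<bar>U z\<bar> \<partial>lborel) < 1" using c by (simp add: A_def)
    qed (use \<open>M \<le> L\<close> in \<open>auto simp: M_def\<close>)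
    then show ?thesis using c by (simp add: S_def)
  qed
  have S_less: "\<eta> < \<theta>" if "M \<le> L" "0 \<le> \<theta>" "perturbation L f" "potential.excess U L \<theta> f < 0" "\<eta> \<in> S L" for L \<theta> f \<eta>
    using potential.not_unique_if_negative_excess[OF pot[OF that(1)] that(3,4)] that(2,5)
    by (auto simp: S_def not_le[symmetric])
  \<comment> \<open>An upper bound makes the real \<open>Sup\<close> a genuine supremum; it comes
    from the negative Fourier coefficient.\<close>
  have bdd: "bdd_above (S L)" if L: "M \<le> L" for L
  proof -
    have "in_VN L V" using L by (intro VN) (simp add: M_def)
    then obtain \<theta> f where "0 \<le> \<theta>" "perturbation L f" "potential.excess U L \<theta> f < 0"
      using potential.in_VN_negative_excess[OF pot[OF L]] by blast
    then show ?thesis using S_less[OF L] by (intro bdd_aboveI[of _ \<theta>]) (auto simp: less_imp_le)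
  qed
  have low: "c \<le> lower_transition L V" if "M \<le> L" for L
    unfolding tS using cS[OF that] bdd[OF that] by (rule cSup_upper)
  have ev: "\<forall>\<^sub>F L' in at_top. lower_transition L' V \<le> \<theta>"
    if LM: "M \<le> L" "lower_transition L V < \<theta>" for L \<theta>
  proof -
    interpret potential V U a L by (rule pot[OF LM(1)])
    \<comment> \<open>The midpoint leaves room on both sides: uniqueness fails at some
      \<open>\<theta>' \<le> \<theta>1\<close>, and passing to the larger \<open>\<theta>\<close>
      makes the excess strictly negative.\<close>
    define \<theta>1 where "\<theta>1 = (lower_transition L V + \<theta>) / 2"
    have \<theta>1: "lower_transition L V < \<theta>1" "\<theta>1 < \<theta>" "0 \<le> \<theta>1" "0 \<le> \<theta>"
      using LM low[OF LM(1)] c by (auto simp: \<theta>1_def)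
    then have "\<theta>1 \<notin> S L" using cSup_upper[OF _ bdd[OF LM(1)], of \<theta>1] by (auto simp: tS)
    then obtain \<theta>' where \<theta>': "0 \<le> \<theta>'" "\<theta>' \<le> \<theta>1" "\<not> unique_min_rho0 L V \<theta>'"
      using \<theta>1 by (auto simp: S_def)
    then obtain f where f: "perturbation L f" "excess \<theta> f < 0"
      using not_unique_imp_negative_excess[of \<theta>' \<theta>] \<theta>1 by auto
    then obtain M' where M': "\<And>L'. M' \<le> L' \<Longrightarrow> \<exists>f'. perturbation L' f' \<and>
        (\<integral>x. psi (f' x) \<partial>lborel) + \<theta> / 2 * pairing U f' (wrap L' f') < 0"
      using negative_energy_transfer[OF U L f(1), of \<theta>] by (auto simp: excess_def)
    show ?thesis
      using eventually_ge_at_top[of "max M M'"]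
    proof eventually_elim
      case (elim L')
      then have L': "M \<le> L'" by simp
      obtain f' where "perturbation L' f'" "potential.excess U L' \<theta> f' < 0"
        using M'[of L'] elim by (auto simp: potential.excess_def[OF pot[OF L']])
      then have "\<eta> \<le> \<theta>" if "\<eta> \<in> S L'" for \<eta> using S_less[OF L' \<theta>1(4)] that by (auto simp: less_imp_le)
      then show ?case unfolding tS using cS[OF L'] by (intro cSup_least) auto
    qed
  qed
  show ?thesis
  proof (intro exI conjI)
    let ?t = "\<lambda>L. lower_transition L V"
    show "(?t \<longlongrightarrow> Inf (?t ` {M..})) at_top"
      by (rule tendsto_Inf_of_eventually_le(1)[where t = ?t]) (fact low ev)+
    have "c \<le> Inf (?t ` {M..})"
      by (rule tendsto_Inf_of_eventually_le(2)[where t = ?t]) (fact low ev)+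
    then show "0 < Inf (?t ` {M..})" using c by linarith
  qed
qed

end
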